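(* Assume that: $g$ is bounded; $f$ is convex and differentiable with $\nabla f$ Lipschitz continuous with constant $L$; for every $\lambda\in\mathcal{H}_f:=\nabla f(\mathcal{H})$, $g_\lambda$ is lower semi-continuous on $Z$, $G_\lambda$ is a lower semi-continuous set-valued map and $\mathrm{BR}_\lambda(x)\ne\emptyset$ for all $x\in X$. Assume moreover that: $X$ is a closed subset of a separable Banach space (with $d_X$ the induced distance); $g\colon Z\to\mathcal{H}$ is continuous; $Z_x$ is compact for every $x\in X$ and $F\colon X\rightsquigarrow Y$ is upper semi-continuous; and there is $L_g\ge0$ such that the set-valued map $\mathcal{Z}\colon X\rightsquigarrow\mathcal{H}$, $\mathcal{Z}(x)=\{g(x,y):y\in Z_x\}$, is $L_g$-Lipschitz. Let $m_0,m_1\in\mathcal{P}^1(X)$, and let $\bar\mu_0\in\mathcal{P}_{m_0}(Z)$ be an $\epsilon_0$-minimizer of problem $(\mathrm{P}_{m_0})$ for some $\epsilon_0\ge0$. Then: (1) $|\mathrm{val}(\mathrm{P}_{m_0})-\mathrm{val}(\mathrm{P}_{m_1})|\le L_g(C+LM)\,d_1(m_0,m_1)$; (2) if $\mu_1\in\mathcal{P}_{m_1}(Z)$ is an output of the bridging method with inputs $m_0,m_1,\bar\mu_0$, then $\mu_1$ is an $\eta$-minimizer of problem $(\mathrm{P}_{m_1})$, where $\eta=\epsilon_0+2L_g(C+LM)\,d_1(m_0,m_1)$.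
   Context: $X$ and $Y$ are complete separable metric spaces with metrics $d_X,d_Y$ and Borel $\sigma$-algebras; $\mathcal{P}(\cdot)$ denotes the set of Borel probability measures. $F\colon X\rightsquigarrow Y$ is a set-valued map with non-empty values and closed graph; $Z_x:=F(x)$, $Z:=\{(x,y): y\in Z_x\}\subseteq X\times Y$. $\mathcal{H}$ is a separable real Hilbert space; $g\colon Z\to\mathcal{H}$ and $f\colon\mathcal{H}\to\mathbb{R}$ are Borel measurable. With $\pi_1(x,y)=x$, $\mathcal{P}_m(Z)=\{\mu\in\mathcal{P}(Z):\pi_1\#\mu=m\}$. Problem $(\mathrm{P}_m)$ is $\inf_{\mu\in\mathcal{P}_m(Z)}f(\int_Z g\,d\mu)$ (Bochner integral) and $\mathrm{val}(\mathrm{P}_m)$ is its value; an $\epsilon$-minimizer is $\mu\in\mathcal{P}_m(Z)$ with $f(\int_Z g\,d\mu)\le\mathrm{val}(\mathrm{P}_m)+\epsilon$. For $\lambda\in\mathcal{H}$: $g_\lambda(x,y)=\langle\lambda,g(x,y)\rangle$, $G_\lambda(x)=\{g_\lambda(x,y):y\in Z_x\}\subseteq\mathbb{R}$, $\mathrm{BR}_\lambda(x)=\operatorname{argmin}_{y\in Z_x}g_\lambda(x,y)$. Constants: $M=\sup_{z\in Z}\|g(z)\|$, $C=\sup_{\mu\in\mathcal{P}(Z)}\|\nabla f(\int_Z g\,d\mu)\|$. Set-valued maps $\Phi$ (non-empty values): lower semi-continuous if for every $x$, $y\in\Phi(x)$ and $x_n\to x$ there are $y_n\in\Phi(x_n)$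 with $y_n\to y$; upper semi-continuous if for every $x$ and every neighborhood $\mathcal{U}$ of $\Phi(x)$ there is $\eta>0$ with $\Phi(x')\subseteq\mathcal{U}$ whenever $d_X(x,x')\le\eta$; $\mathcal{Z}$ is $L_g$-Lipschitz if $\mathcal{Z}(x_1)\subseteq\mathcal{Z}(x_2)+B_{\mathcal{H}}(0,L_g d_X(x_1,x_2))$ for all $x_1,x_2\in X$ (closed ball). $\mathcal{P}^1(X)$ is the set of $m\in\mathcal{P}(X)$ with $\int d_X(x,x_0)\,dm(x)<\infty$ for some $x_0\in X$; $d_1(m_0,m_1)=\sup\{\int_X h\,d(m_0-m_1): h\colon X\to\mathbb{R}\text{ 1-Lipschitz}\}$. Bridging method, with inputs $m_0,m_1,\bar\mu_0$: (Step 1) take a solution $\rho$ of the optimal transport problem $\inf_{\rho\in\Pi(m_0,m_1)}\int_{X\times X}d_X(x,x')\,d\rho(x,x')$, where $\Pi(m_0,m_1)$ is the set of probability measures on $X\times X$ with marginals $m_0,m_1$; (Step 2) take $\nu\in\mathcal{P}(Z\times X)$ such that $\pi_{12}\#\nu=\bar\mu_0$ and $\pi_{13}\#\nu=\rho$, where $\pi_{12}(x,y,x')=(x,y)$, $\pi_{13}(x,y,x')=(x,x')$; (Step 3) output $\mu_1=s\#\nu$, where $s\colon Z\times X\to Z$ is a Borel measurable selection of the set-valued map $S(x,y,x')=\{(x',y')\in Z:\|g(x',y')-g(x,y)\|\le L_g d_X(x,x')\}$, i.e. $s(x,y,x')\in S(x,y,x')$ for all $(x,y,x')$. *)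

theory Defs
  imports "HOL-Probability.Probability"
begin

text \<open>
  The metric space \<open>X\<close> is a subset of a Banach space type, so set-valued maps on \<open>X\<close> are
  functions \<open>'x \<Rightarrow> 'y set\<close> of which only the values on \<open>X\<close> matter, and Borel
  probability measures on a subset are measures whose space is that subset.
\<close>

definition graph_on :: "'a set \<Rightarrow> ('a \<Rightarrow> 'b set) \<Rightarrow> ('a \<times> 'b) set" where
  "graph_on X F = {(x, y). x \<in> X \<and> y \<in> F x}"

definition svm_lsc_on ::
    "'a::topological_space set \<Rightarrow> ('a \<Rightarrow> 'b::topological_space set) \<Rightarrow> bool" where
  "svm_lsc_on X \<Phi> \<longleftrightarrow>
    (\<forall>x\<in>X. \<forall>y\<in>\<Phi> x. \<forall>xs. (\<forall>n. xs n \<in> X) \<and> xs \<longlonglongrightarrow> x \<longrightarrow>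
      (\<exists>ys::nat \<Rightarrow> 'b. (\<forall>n. ys n \<in> \<Phi> (xs n)) \<and> ys \<longlonglongrightarrow> y))"

definition svm_usc_on ::
    "'a::metric_space set \<Rightarrow> ('a \<Rightarrow> 'b::topological_space set) \<Rightarrow> bool" where
  "svm_usc_on X \<Phi> \<longleftrightarrow>
    (\<forall>x\<in>X. \<forall>U. \<Phi> x \<subseteq> interior U \<longrightarrow>
      (\<exists>\<eta>>0. \<forall>x'\<in>X. dist x x' \<le> \<eta> \<longrightarrow> \<Phi> x' \<subseteq> U))"

definition svm_lipschitz_on ::
    "real \<Rightarrow> 'a::metric_space set \<Rightarrow> ('a \<Rightarrow> 'b::real_normed_vector set) \<Rightarrow> bool" where
  "svm_lipschitz_on K X \<Phi> \<longleftrightarrow>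
    (\<forall>x1\<in>X. \<forall>x2\<in>X. \<Phi> x1 \<subseteq> {u + v | u v. u \<in> \<Phi> x2 \<and> v \<in> cball 0 (K * dist x1 x2)})"

definition lsc_on :: "'a::topological_space set \<Rightarrow> ('a \<Rightarrow> real) \<Rightarrow> bool" where
  "lsc_on S h \<longleftrightarrow> (\<forall>z\<in>S. \<forall>a<h z. eventually (\<lambda>z'. a < h z') (at z within S))"

definition best_response ::
    "('x \<Rightarrow> 'y set) \<Rightarrow> ('x \<times> 'y \<Rightarrow> 'h::real_inner) \<Rightarrow> 'h \<Rightarrow> 'x \<Rightarrow> 'y set" where
  "best_response F g l x = {y. is_arg_min (\<lambda>y. inner l (g (x, y))) (\<lambda>y. y \<in> F x) y}"

definition borel_probs :: "'a::topological_space set \<Rightarrow> 'a measure set" where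
  "borel_probs S = {\<mu>. prob_space \<mu> \<and> sets \<mu> = sets (restrict_space borel S)}"

definition borel_probs_1 :: "'a::metric_space set \<Rightarrow> 'a measure set" where
  "borel_probs_1 X =
    {m \<in> borel_probs X. \<exists>x0\<in>X. (\<integral>\<^sup>+x. ennreal (dist x x0) \<partial>m) < \<infinity>}"

text \<open>The set over which the supremum is taken is bounded when \<open>m0\<close> and \<open>m1\<close> have finite first
  moments, so the real-valued supremum is the intended one.\<close>

definition kr_dist :: "'a::metric_space set \<Rightarrow> 'a measure \<Rightarrow> 'a measure \<Rightarrow> real" where
  "kr_dist X m0 m1 =
    (SUP h\<in>{h :: 'a \<Rightarrow> real. 1-lipschitz_on X h}. (\<integral>x. h x \<partial>m0) - (\<integral>x. h x \<partial>m1))"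

definition couplings ::
    "'a::topological_space set \<Rightarrow> 'a measure \<Rightarrow> 'a measure \<Rightarrow> ('a \<times> 'a) measure set" where
  "couplings X m0 m1 =
    {\<rho> \<in> borel_probs (X \<times> X).
      distr \<rho> (restrict_space borel X) fst = m0 \<and> distr \<rho> (restrict_space borel X) snd = m1}"

definition optimal_transport ::
    "'a::metric_space set \<Rightarrow> 'a measure \<Rightarrow> 'a measure \<Rightarrow> ('a \<times> 'a) measure \<Rightarrow> bool" where
  "optimal_transport X m0 m1 \<rho> \<longleftrightarrow>
    \<rho> \<in> couplings X m0 m1 \<and>
    (\<forall>\<rho>'\<in>couplings X m0 m1.
      (\<integral>\<^sup>+p. ennreal (dist (fst p) (snd p)) \<partial>\<rho>) \<le> (\<integral>\<^sup>+p. ennreal (dist (fst p) (snd p)) \<partial>\<rho>'))"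

definition admissible ::
    "'x::topological_space set \<Rightarrow> ('x \<times> 'y::topological_space) set \<Rightarrow> 'x measure
      \<Rightarrow> ('x \<times> 'y) measure set" where
  "admissible X Z m = {\<mu> \<in> borel_probs Z. distr \<mu> (restrict_space borel X) fst = m}"

text \<open>The value is the infimum in the reals; it is the intended one as soon as the problem is
  feasible and its cost is bounded from below.\<close>

definition prob_val ::
    "'x::topological_space set \<Rightarrow> ('x \<times> 'y::topological_space) set
      \<Rightarrow> ('x \<times> 'y \<Rightarrow> 'h::{banach, second_countable_topology}) \<Rightarrow> ('h \<Rightarrow> real) \<Rightarrow> 'x measure \<Rightarrow> real" where
  "prob_val X Z g f m = (INF \<mu>\<in>admissible X Z m. f (\<integral>z. g z \<partial>\<mu>))"

definition eps_minimizer ::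
    "'x::topological_space set \<Rightarrow> ('x \<times> 'y::topological_space) set
      \<Rightarrow> ('x \<times> 'y \<Rightarrow> 'h::{banach, second_countable_topology}) \<Rightarrow> ('h \<Rightarrow> real) \<Rightarrow> 'x measure
      \<Rightarrow> real \<Rightarrow> ('x \<times> 'y) measure \<Rightarrow> bool" where
  "eps_minimizer X Z g f m \<epsilon> \<mu> \<longleftrightarrow>
    \<mu> \<in> admissible X Z m \<and> f (\<integral>z. g z \<partial>\<mu>) \<le> prob_val X Z g f m + \<epsilon>"

definition bridge_map ::
    "('x::metric_space \<times> 'y) set \<Rightarrow> ('x \<times> 'y \<Rightarrow> 'h::real_normed_vector) \<Rightarrow> real
      \<Rightarrow> ('x \<times> 'y) \<times> 'x \<Rightarrow> ('x \<times> 'y) set" where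
  "bridge_map Z g K = (\<lambda>((x, y), x').
    {(a, y'). a = x' \<and> (x', y') \<in> Z \<and> norm (g (x', y') - g (x, y)) \<le> K * dist x x'})"

definition bridging_output ::
    "'x::metric_space set \<Rightarrow> ('x \<times> 'y::metric_space) set
      \<Rightarrow> ('x \<times> 'y \<Rightarrow> 'h::real_normed_vector) \<Rightarrow> real
      \<Rightarrow> 'x measure \<Rightarrow> 'x measure \<Rightarrow> ('x \<times> 'y) measure \<Rightarrow> ('x \<times> 'y) measure \<Rightarrow> bool" where
  "bridging_output X Z g K m0 m1 \<mu>0 \<mu>1 \<longleftrightarrow>
    (\<exists>\<rho> \<nu> s.
      optimal_transport X m0 m1 \<rho> \<and>
      \<nu> \<in> borel_probs (Z \<times> X) \<and>
      distr \<nu> (restrict_space borel Z) fst = \<mu>0 \<and>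
      distr \<nu> (restrict_space borel (X \<times> X)) (\<lambda>((x, y), x'). (x, x')) = \<rho> \<and>
      s \<in> measurable (restrict_space borel (Z \<times> X)) (restrict_space borel Z) \<and>
      (\<forall>p\<in>Z \<times> X. s p \<in> bridge_map Z g K p) \<and>
      \<mu>1 = distr \<nu> (restrict_space borel Z) s)"

end

theory Submission
  imports Defs
begin

text \<open>
  The estimate \<open>|val m\<^sub>0 - val m\<^sub>1| \<le> L\<^sub>g C d\<^sub>1(m\<^sub>0, m\<^sub>1)\<close> needs no transport plan. At a near minimiser \<open>\<mu>\<close>
  for \<open>m\<^sub>0\<close> put \<open>u = \<integral> g d\<mu>\<close> and \<open>\<lambda> = \<nabla>f u\<close>. Perturbing \<open>\<mu>\<close> towards a measure carried by a measurable
  selection of the best responses shows \<open>\<langle>\<lambda>, u\<rangle> \<le> \<integral> h dm\<^sub>0 + \<epsilon>\<close>, where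
  \<open>h x = min\<^bsub>y \<in> F x\<^esub> \<langle>\<lambda>, g(x, y)\<rangle>\<close>. The function \<open>h\<close> is \<open>|\<lambda>| L\<^sub>g\<close>-Lipschitz with \<open>|\<lambda>| \<le> C\<close>, and
  convexity gives \<open>f u' \<ge> f u + \<langle>\<lambda>, u' - u\<rangle> \<ge> val m\<^sub>0 + \<integral> h dm\<^sub>1 - \<integral> h dm\<^sub>0 - \<epsilon>\<close> for every \<open>u'\<close>
  admissible for \<open>m\<^sub>1\<close>.

  An output \<open>\<mu>\<^sub>1\<close> of the bridging method satisfies \<open>|\<integral> g d\<mu>\<^sub>1 - \<integral> g d\<mu>\<^sub>0| \<le> L\<^sub>g \<integral> d d\<rho>\<close>, so the second claim
  follows once the cost of an optimal plan \<open>\<rho>\<close> is at most \<open>d\<^sub>1(m\<^sub>0, m\<^sub>1)\<close>. Since \<open>\<rho>\<close> is given, it is enough to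
  construct \<open>\<epsilon>\<close>-optimal plans; for finitely many points these come from the stationarity condition
  of a dual problem with quadratic penalty.
\<close>

section \<open>Finite transport duality\<close>

text \<open>Near \<open>t = 0\<close> a quadratic term cannot dominate a non-zero linear one. This
  extracts a stationarity equation from maximality without differentiating a positive part.\<close>

lemma zero_if_linear_le_square:
  fixes a c :: real
  assumes "\<And>t. t * a \<le> c * t\<^sup>2"
  shows "a = 0"
proof (rule ccontr)
  assume "a \<noteq> 0"
  \<comment> \<open>With this \<open>t\<close> the linear term equals
    \<open>(\<bar>c\<bar> + 1) * t^2\<close>, which exceeds \<open>c * t^2\<close>; the summand
    \<open>1\<close> keeps the denominator positive.\<close>
  define t where "t = a / (\<bar>c\<bar> + 1)"
  have t: "t * (\<bar>c\<bar> + 1) = a"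
    by (simp add: t_def)
  with \<open>a \<noteq> 0\<close> have "t \<noteq> 0"
    by auto
  have "t * a = (\<bar>c\<bar> + 1) * t\<^sup>2"
    by (simp add: power2_eq_square flip: t)
  moreover have "c * t\<^sup>2 < (\<bar>c\<bar> + 1) * t\<^sup>2"
    using \<open>t \<noteq> 0\<close> by (intro mult_strict_right_mono) auto
  ultimately show False
    using assms[of t] by simp
qed

text \<open>Since \<open>max 0 (x + t)\<close> is at most \<open>\<bar>max 0 x + t\<bar>\<close>,
  the square of the positive part lies below its first-order expansion, of slope
  \<open>2 * max 0 x\<close>, plus \<open>t^2\<close>.\<close>

lemma pos_part_square_add_le:
  fixes x t :: real
  shows "(max 0 (x + t))\<^sup>2 \<le> (max 0 x)\<^sup>2 + 2 * t * max 0 x + t\<^sup>2"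
proof -
  have "max 0 (x + t) \<le> \<bar>max 0 x + t\<bar>"
    by (auto simp: max_def)
  then have "(max 0 (x + t))\<^sup>2 \<le> (max 0 x + t)\<^sup>2"
    by (metis max.cobounded1 power2_abs power_mono)
  then show ?thesis
    by (simp add: power2_sum algebra_simps)
qed

text \<open>Tychonoff's theorem in the product topology of the function space.\<close>

lemma compact_function_box:
  fixes R :: real
  shows "compact {f :: 'a \<Rightarrow> real. \<forall>i. f i \<in> {-R..R}}"
proof -
  have "compactin (product_topology (\<lambda>i::'a. euclideanreal) UNIV) (PiE UNIV (\<lambda>i. {-R..R}))"
    by (subst compactin_PiE) auto
  moreover have "PiE UNIV (\<lambda>i::'a. {-R..R}) = {f. \<forall>i. f i \<in> {-R..R}}"
    by auto
  ultimately show ?thesis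
    by (simp add: euclidean_product_topology)
qed

text \<open>The Kantorovich dual functional in which the constraint
  \<open>\<phi> i + \<psi> j \<le> c i j\<close> is replaced by a quadratic penalty on its
  violation, so that the maximisation is unconstrained.\<close>

definition penalised_dual ::
    "'a set \<Rightarrow> 'b set \<Rightarrow> ('a \<Rightarrow> real) \<Rightarrow> ('b \<Rightarrow> real) \<Rightarrow> ('a \<Rightarrow> 'b \<Rightarrow> real) \<Rightarrow> real
      \<Rightarrow> ('a \<Rightarrow> real) \<Rightarrow> ('b \<Rightarrow> real) \<Rightarrow> real" where
  "penalised_dual I J p q c \<beta> \<phi> \<psi> =
    (\<Sum>i\<in>I. \<phi> i * p i) + (\<Sum>j\<in>J. \<psi> j * q j)
      - \<beta> / 2 * (\<Sum>i\<in>I. \<Sum>j\<in>J. (max 0 (\<phi> i + \<psi> j - c i j))\<^sup>2)"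

text \<open>The two potentials play symmetric roles, so the column marginals follow from the
  statement about rows.\<close>

lemma penalised_dual_swap:
  "penalised_dual J I q p (\<lambda>j i. c i j) \<beta> \<psi> \<phi> = penalised_dual I J p q c \<beta> \<phi> \<psi>"
  unfolding penalised_dual_def by (subst sum.swap) (simp add: add.commute)

text \<open>The value is invariant under \<open>(\<phi>, \<psi>) \<mapsto> (\<phi> + t, \<psi> - t)\<close>, and modulo this shift its
  superlevel set at \<open>0\<close> is bounded.\<close>

lemma penalised_dual_attains_max:
  fixes c :: "'a \<Rightarrow> 'b \<Rightarrow> real"
  assumes fin: "finite I" "finite J"
    and pos: "\<And>i. i \<in> I \<Longrightarrow> 0 < p i" "\<And>j. j \<in> J \<Longrightarrow> 0 < q j"
    and mass: "sum p I = 1" "sum q J = 1"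
    and c: "\<And>i j. i \<in> I \<Longrightarrow> j \<in> J \<Longrightarrow> 0 \<le> c i j"
    and \<beta>: "0 < \<beta>"
  shows "\<exists>\<phi> \<psi>. \<forall>\<phi>' \<psi>'. penalised_dual I J p q c \<beta> \<phi>' \<psi>' \<le> penalised_dual I J p q c \<beta> \<phi> \<psi>"
proof -
  let ?D = "penalised_dual I J p q c \<beta>"
  have ne: "I \<noteq> {}" "J \<noteq> {}"
    using mass by auto
  \<comment> \<open>A crude common upper bound for all costs.\<close>
  define D where "D = (\<Sum>i\<in>I. \<Sum>j\<in>J. c i j)"
  have D: "c i j \<le> D" if "i \<in> I" "j \<in> J" for i j
  proof -
    have "c i j \<le> (\<Sum>j\<in>J. c i j)"
      using that fin c by (intro member_le_sum) auto
    also have "\<dots> \<le> D"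
      unfolding D_def using that fin c by (intro member_le_sum[of i I "\<lambda>i. \<Sum>j\<in>J. c i j"] sum_nonneg) auto
    finally show ?thesis .
  qed
  have D0: "0 \<le> D"
    unfolding D_def using c by (intro sum_nonneg) auto
  \<comment> \<open>\<open>T\<close> bounds the sum \<open>t\<close> of the two maxima of the
    potentials on the superlevel set. If \<open>t > 2 * D\<close>, the penalty term at these maxima
    is at least \<open>\<beta> / 2 * (t / 2)^2\<close>; it must stay below \<open>t\<close>, hence
    \<open>t < 8 / \<beta>\<close>.\<close>
  define T where "T = 2 * D + 8 / \<beta>"
  have T0: "0 \<le> T"
    using D0 \<beta> by (simp add: T_def)
  \<comment> \<open>The radius covers the upper bound \<open>T\<close> and the lower bounds
    \<open>- T / p i\<close> and \<open>- T / q j\<close> of the normalised potentials.\<close>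
  define R where "R = T + (\<Sum>i\<in>I. T / p i) + (\<Sum>j\<in>J. T / q j)"
  have nn: "0 \<le> (\<Sum>i\<in>I. T / p i)" "0 \<le> (\<Sum>j\<in>J. T / q j)"
    using T0 pos by (auto intro!: sum_nonneg divide_nonneg_pos)
  have RT: "T \<le> R" "0 \<le> R"
    using nn T0 by (auto simp: R_def)
  have Rp: "T / p i \<le> R" if "i \<in> I" for i
  proof -
    have "T / p i \<le> (\<Sum>i\<in>I. T / p i)"
      using that fin T0 pos
      by (intro member_le_sum[of i I "\<lambda>i. T / p i"]) (auto intro: divide_nonneg_pos)
    then show ?thesis
      using nn T0 by (simp add: R_def)
  qed
  have Rq: "T / q j \<le> R" if "j \<in> J" for j
  proof -
    have "T / q j \<le> (\<Sum>j\<in>J. T / q j)"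
      using that fin T0 pos
      by (intro member_le_sum[of j J "\<lambda>i. T / q i"]) (auto intro: divide_nonneg_pos)
    then show ?thesis
      using nn T0 by (simp add: R_def)
  qed
  let ?K = "{f. \<forall>i. f i \<in> {-R..R}}"
  have "continuous_on (?K \<times> ?K) (\<lambda>z. ?D (fst z) (snd z))"
  proof -
    have 1: "continuous_on S (\<lambda>z::('a \<Rightarrow> real) \<times> ('b \<Rightarrow> real). fst z i)" for S i
      using continuous_on_compose2[OF continuous_on_product_coordinates continuous_on_fst[OF continuous_on_id]]
      by auto
    have 2: "continuous_on S (\<lambda>z::('a \<Rightarrow> real) \<times> ('b \<Rightarrow> real). snd z i)" for S i
      using continuous_on_compose2[OF continuous_on_product_coordinates continuous_on_snd[OF continuous_on_id]]
      by auto
    show ?thesis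
      unfolding penalised_dual_def by (intro continuous_intros 1 2)
  qed
  moreover have "compact (?K \<times> ?K)"
    by (intro compact_Times compact_function_box)
  moreover have "((\<lambda>_. 0), (\<lambda>_. 0)) \<in> ?K \<times> ?K"
    using RT by auto
  ultimately have "\<exists>z\<in>?K \<times> ?K. \<forall>w\<in>?K \<times> ?K. ?D (fst w) (snd w) \<le> ?D (fst z) (snd z)"
    by (intro continuous_attains_sup) (auto simp del: atLeastAtMost_iff)
  then obtain z where z: "z \<in> ?K \<times> ?K"
    and zmax': "\<forall>w\<in>?K \<times> ?K. ?D (fst w) (snd w) \<le> ?D (fst z) (snd z)"
    by (rule bexE)
  have zmax: "?D (fst w) (snd w) \<le> ?D (fst z) (snd z)" if "w \<in> ?K \<times> ?K" for w
    using zmax' that by (rule bspec)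
  \<comment> \<open>Costs are non-negative, so zero potentials violate no constraint. Hence only
    potentials with positive value have to be moved into the box.\<close>
  have zero: "?D (\<lambda>_. 0) (\<lambda>_. 0) = 0"
  proof -
    have "(\<Sum>i\<in>I. \<Sum>j\<in>J. (max 0 (0 + 0 - c i j))\<^sup>2) = 0"
      using c by (intro sum.neutral ballI) (auto simp: max_def intro: antisym)
    then show ?thesis
      by (simp add: penalised_dual_def)
  qed
  have nonneg: "0 \<le> ?D (fst z) (snd z)"
    using zmax[of "((\<lambda>_. 0), (\<lambda>_. 0))"] RT zero by auto
  have "?D \<phi>' \<psi>' \<le> ?D (fst z) (snd z)" for \<phi>' \<psi>'
  proof (cases "?D \<phi>' \<psi>' \<le> 0")
    case True
    then show ?thesis using nonneg by simp
  next
    case False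
    let ?S = "(\<Sum>i\<in>I. \<phi>' i * p i) + (\<Sum>j\<in>J. \<psi>' j * q j)"
    let ?P = "\<Sum>i\<in>I. \<Sum>j\<in>J. (max 0 (\<phi>' i + \<psi>' j - c i j))\<^sup>2"
    \<comment> \<open>Shifting by \<open>b\<close> brings the maximum of the second potential to
      \<open>0\<close>, and that of the first to \<open>t\<close>.\<close>
    define b where "b = Max (\<psi>' ` J)"
    define t where "t = Max (\<phi>' ` I) + b"
    have le: "\<phi>' i + b \<le> t" if "i \<in> I" for i
      using that fin by (simp add: t_def)
    have leb: "\<psi>' j \<le> b" if "j \<in> J" for j
      using that fin by (simp add: b_def)
    have "?S \<le> (\<Sum>i\<in>I. (t - b) * p i) + (\<Sum>j\<in>J. b * q j)"
      using pos le leb by (intro add_mono sum_mono mult_right_mono) (auto simp: less_imp_le algebra_simps)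
    also have "\<dots> = t"
      by (simp add: mass flip: sum_distrib_left)
    finally have S: "?S \<le> t" .
    have P: "0 \<le> ?P"
      by (intro sum_nonneg) auto
    have SP: "\<beta> / 2 * ?P < ?S"
      using False by (simp add: penalised_dual_def)
    have S0: "0 \<le> ?S"
      using SP P \<beta> by (smt (verit) divide_nonneg_nonneg mult_nonneg_nonneg)
    have "t \<le> T"
    proof (rule ccontr)
      assume t: "\<not> t \<le> T"
      obtain i where i: "i \<in> I" "\<phi>' i = Max (\<phi>' ` I)"
        using Max_in[of "\<phi>' ` I"] fin ne by fastforce
      obtain j where j: "j \<in> J" "\<psi>' j = b"
        unfolding b_def using Max_in[of "\<psi>' ` J"] fin ne by fastforce
      have T': "2 * D < t" "8 / \<beta> < t" "0 < t"
        using t D0 \<beta> T0 by (auto simp: T_def add_nonneg_pos) (smt (verit) divide_pos_pos)+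
      have "(t / 2)\<^sup>2 \<le> (max 0 (\<phi>' i + \<psi>' j - c i j))\<^sup>2"
        using T' D[OF i(1) j(1)] i j by (intro power_mono) (auto simp: t_def)
      also have "\<dots> \<le> (\<Sum>j\<in>J. (max 0 (\<phi>' i + \<psi>' j - c i j))\<^sup>2)"
        using j fin by (intro member_le_sum[of j J "\<lambda>j. (max 0 (\<phi>' i + \<psi>' j - c i j))\<^sup>2"]) auto
      also have "\<dots> \<le> ?P"
        using i fin
        by (intro member_le_sum[of i I "\<lambda>i. \<Sum>j\<in>J. (max 0 (\<phi>' i + \<psi>' j - c i j))\<^sup>2"] sum_nonneg) auto
      finally have "\<beta> / 2 * (t / 2)\<^sup>2 \<le> \<beta> / 2 * ?P"
        using \<beta> by (intro mult_left_mono) auto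
      then have "\<beta> / 2 * (t / 2)\<^sup>2 < t"
        using SP S by linarith
      then have "\<beta> * t * t < 8 * t"
        by (simp add: power2_eq_square)
      then have "\<beta> * t < 8"
        using \<open>0 < t\<close> by simp
      then show False
        using T'(2) \<beta> by (simp add: field_simps)
    qed
    \<comment> \<open>The value depends only on \<open>I\<close> and \<open>J\<close>; setting the
      potentials to \<open>0\<close> elsewhere puts them into a box over the whole type.\<close>
    define \<phi>'' where "\<phi>'' = (\<lambda>i. if i \<in> I then \<phi>' i + b else 0)"
    define \<psi>'' where "\<psi>'' = (\<lambda>j. if j \<in> J then \<psi>' j - b else 0)"
    have sums: "(\<Sum>i\<in>I. \<phi>'' i * p i) = (\<Sum>i\<in>I. \<phi>' i * p i) + b"
      "(\<Sum>j\<in>J. \<psi>'' j * q j) = (\<Sum>j\<in>J. \<psi>' j * q j) - b"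
      by (simp_all add: \<phi>''_def \<psi>''_def distrib_right left_diff_distrib sum.distrib sum_subtractf mass
          flip: sum_distrib_left cong: sum.cong)
    have shift: "?D \<phi>'' \<psi>'' = ?D \<phi>' \<psi>'"
    proof -
      have "(\<Sum>i\<in>I. \<Sum>j\<in>J. (max 0 (\<phi>'' i + \<psi>'' j - c i j))\<^sup>2) = ?P"
        by (intro sum.cong) (auto simp: \<phi>''_def \<psi>''_def)
      then show ?thesis
        unfolding penalised_dual_def sums by simp
    qed
    have up: "\<phi>'' i \<le> T" "\<psi>'' j \<le> 0" for i j
      using le[of i] leb[of j] \<open>t \<le> T\<close> T0 by (auto simp: \<phi>''_def \<psi>''_def)
    have S'': "0 \<le> (\<Sum>i\<in>I. \<phi>'' i * p i) + (\<Sum>j\<in>J. \<psi>'' j * q j)"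
      using S0 unfolding sums by simp
    have \<phi>T: "(\<Sum>i\<in>A. \<phi>'' i * p i) \<le> T" if "A \<subseteq> I" for A
    proof -
      have "(\<Sum>i\<in>A. \<phi>'' i * p i) \<le> (\<Sum>i\<in>A. T * p i)"
        using up pos that by (intro sum_mono mult_right_mono) (auto simp: less_imp_le)
      also have "\<dots> \<le> (\<Sum>i\<in>I. T * p i)"
        using that fin pos T0 by (intro sum_mono2) (auto simp: less_imp_le)
      also have "\<dots> = T"
        by (simp add: mass flip: sum_distrib_left)
      finally show ?thesis .
    qed
    have \<psi>0: "(\<Sum>j\<in>B. \<psi>'' j * q j) \<le> 0" if "B \<subseteq> J" for B
      using up pos that by (intro sum_nonpos mult_nonpos_nonneg) (auto simp: less_imp_le)
    have "-R \<le> \<phi>'' i" for i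
    proof (cases "i \<in> I")
      case True
      \<comment> \<open>The total of both sums is non-negative, the other terms of the first
        contribute at most \<open>T\<close> and the second at most \<open>0\<close>, so this one
        term cannot fall below \<open>- T\<close>.\<close>
      have "- T \<le> \<phi>'' i * p i"
        using S'' \<psi>0[of J] \<phi>T[of "I - {i}"] sum.remove[OF fin(1) True, of "\<lambda>i. \<phi>'' i * p i"] by auto
      then have "- (T / p i) \<le> \<phi>'' i"
        using pos(1)[OF True] by (simp add: field_simps)
      then show ?thesis
        using Rp[OF True] by linarith
    qed (use RT in \<open>auto simp: \<phi>''_def\<close>)
    moreover have "-R \<le> \<psi>'' j" for j
    proof (cases "j \<in> J")
      case True
      have "- T \<le> \<psi>'' j * q j"
        using S'' \<phi>T[of I] \<psi>0[of "J - {j}"] sum.remove[OF fin(2) True, of "\<lambda>j. \<psi>'' j * q j"] by auto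
      then have "- (T / q j) \<le> \<psi>'' j"
        using pos(2)[OF True] by (simp add: field_simps)
      then show ?thesis
        using Rq[OF True] by linarith
    qed (use RT in \<open>auto simp: \<psi>''_def\<close>)
    moreover have "\<phi>'' i \<le> R" "\<psi>'' j \<le> R" for i j
      using up(1)[of i] up(2)[of j] RT by auto
    ultimately have "(\<phi>'', \<psi>'') \<in> ?K \<times> ?K"
      by auto
    from zmax[OF this] shift show ?thesis
      by simp
  qed
  then show ?thesis
    by blast
qed

text \<open>First-order condition in the single coordinate \<open>\<phi> i\<close>: moving it by
  \<open>t\<close> raises the value by at least \<open>t\<close> times the defect of the marginal,
  minus a multiple of \<open>t^2\<close>. Maximality forces the defect to vanish.\<close>

lemma penalised_dual_max_marginal:
  fixes c :: "'a \<Rightarrow> 'b \<Rightarrow> real"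
  assumes fin: "finite I" "finite J" and i: "i \<in> I"
    and max: "\<And>\<phi>'. penalised_dual I J p q c \<beta> \<phi>' \<psi> \<le> penalised_dual I J p q c \<beta> \<phi> \<psi>"
    and \<beta>: "0 < \<beta>"
  shows "(\<Sum>j\<in>J. \<beta> * max 0 (\<phi> i + \<psi> j - c i j)) = p i"
proof -
  let ?r = "\<lambda>\<phi> i j. max 0 (\<phi> i + \<psi> j - c i j)"
  have "t * (p i - (\<Sum>j\<in>J. \<beta> * ?r \<phi> i j)) \<le> \<beta> / 2 * card J * t\<^sup>2" for t
  proof -
    define \<phi>' where "\<phi>' = \<phi>(i := \<phi> i + t)"
    have "(\<Sum>j\<in>J. (?r \<phi>' i j)\<^sup>2) \<le> (\<Sum>j\<in>J. (?r \<phi> i j)\<^sup>2 + 2 * t * ?r \<phi> i j + t\<^sup>2)"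
    proof (rule sum_mono)
      fix j
      show "(?r \<phi>' i j)\<^sup>2 \<le> (?r \<phi> i j)\<^sup>2 + 2 * t * ?r \<phi> i j + t\<^sup>2"
        using pos_part_square_add_le[of "\<phi> i + \<psi> j - c i j" t]
        by (simp add: \<phi>'_def algebra_simps)
    qed
    then have le: "(\<Sum>j\<in>J. (?r \<phi>' i j)\<^sup>2) \<le>
        (\<Sum>j\<in>J. (?r \<phi> i j)\<^sup>2) + 2 * t * (\<Sum>j\<in>J. ?r \<phi> i j) + card J * t\<^sup>2"
      by (simp add: sum.distrib sum_distrib_left)
    have rest: "(\<Sum>k\<in>I - {i}. \<phi>' k * p k) = (\<Sum>k\<in>I - {i}. \<phi> k * p k)"
      "(\<Sum>k\<in>I - {i}. \<Sum>j\<in>J. (?r \<phi>' k j)\<^sup>2) = (\<Sum>k\<in>I - {i}. \<Sum>j\<in>J. (?r \<phi> k j)\<^sup>2)"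
      by (intro sum.cong; simp add: \<phi>'_def)+
    have "\<phi>' i * p i - \<beta> / 2 * (\<Sum>j\<in>J. (?r \<phi>' i j)\<^sup>2)
        \<le> \<phi> i * p i - \<beta> / 2 * (\<Sum>j\<in>J. (?r \<phi> i j)\<^sup>2)"
      using max[of \<phi>'] rest
      unfolding penalised_dual_def sum.remove[OF fin(1) i] by (simp add: distrib_left)
    moreover have "\<phi>' i * p i = \<phi> i * p i + t * p i"
      by (simp add: \<phi>'_def algebra_simps)
    ultimately have "t * p i \<le> \<beta> / 2 * ((\<Sum>j\<in>J. (?r \<phi>' i j)\<^sup>2) - (\<Sum>j\<in>J. (?r \<phi> i j)\<^sup>2))"
      unfolding right_diff_distrib by linarith
    also have "\<dots> \<le> \<beta> / 2 * (2 * t * (\<Sum>j\<in>J. ?r \<phi> i j) + card J * t\<^sup>2)"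
      using le \<beta> by (intro mult_left_mono) auto
    finally show ?thesis
      by (simp add: algebra_simps flip: sum_distrib_left)
  qed
  from zero_if_linear_le_square[OF this] show ?thesis
    by simp
qed

text \<open>The penalty coefficient is \<open>\<beta> = 1 / \<kappa>\<close>, and the plan is
  \<open>\<pi> i j = \<beta> max 0 (\<phi> i + \<psi> j - c i j)\<close> for a maximiser \<open>(\<phi>, \<psi>)\<close>:
  stationarity says that \<open>\<pi>\<close> has the right marginals, and \<open>\<pi> \<le> 1\<close> bounds the violation of the
  dual constraint by \<open>\<kappa>\<close>.\<close>

lemma finite_transport_duality:
  fixes c :: "'a \<Rightarrow> 'b \<Rightarrow> real"
  assumes fin: "finite I" "finite J"
    and pos: "\<And>i. i \<in> I \<Longrightarrow> 0 < p i" "\<And>j. j \<in> J \<Longrightarrow> 0 < q j"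
    and mass: "sum p I = 1" "sum q J = 1"
    and c: "\<And>i j. i \<in> I \<Longrightarrow> j \<in> J \<Longrightarrow> 0 \<le> c i j"
    and \<kappa>: "0 < \<kappa>"
  shows "\<exists>\<pi> \<phi> \<psi>. (\<forall>i j. (0::real) \<le> \<pi> i j) \<and>
    (\<forall>i\<in>I. (\<Sum>j\<in>J. \<pi> i j) = p i) \<and> (\<forall>j\<in>J. (\<Sum>i\<in>I. \<pi> i j) = q j) \<and>
    (\<forall>i\<in>I. \<forall>j\<in>J. \<phi> i + \<psi> j \<le> c i j + \<kappa>) \<and>
    (\<Sum>i\<in>I. \<Sum>j\<in>J. \<pi> i j * c i j) \<le> (\<Sum>i\<in>I. \<phi> i * p i) + (\<Sum>j\<in>J. \<psi> j * q j)"
proof -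
  define \<beta> where "\<beta> = 1 / \<kappa>"
  have \<beta>: "0 < \<beta>"
    using \<kappa> by (simp add: \<beta>_def)
  have "\<exists>\<phi> \<psi>. \<forall>\<phi>' \<psi>'. penalised_dual I J p q c \<beta> \<phi>' \<psi>' \<le> penalised_dual I J p q c \<beta> \<phi> \<psi>"
    by (rule penalised_dual_attains_max) (fact fin pos mass c \<beta>)+
  then obtain \<phi> where "\<exists>\<psi>. \<forall>\<phi>' \<psi>'. penalised_dual I J p q c \<beta> \<phi>' \<psi>' \<le> penalised_dual I J p q c \<beta> \<phi> \<psi>"
    by (rule exE)
  then obtain \<psi> where "\<forall>\<phi>' \<psi>'. penalised_dual I J p q c \<beta> \<phi>' \<psi>' \<le> penalised_dual I J p q c \<beta> \<phi> \<psi>"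
    by (rule exE)
  then have max: "penalised_dual I J p q c \<beta> \<phi>' \<psi>' \<le> penalised_dual I J p q c \<beta> \<phi> \<psi>" for \<phi>' \<psi>'
    by (simp only:)
  define \<pi> where "\<pi> i j = \<beta> * max 0 (\<phi> i + \<psi> j - c i j)" for i j
  have \<pi>0: "0 \<le> \<pi> i j" for i j
    using \<beta> by (simp add: \<pi>_def)
  have row: "(\<Sum>j\<in>J. \<pi> i j) = p i" if "i \<in> I" for i
    unfolding \<pi>_def
    by (rule penalised_dual_max_marginal[where c=c and q=q and \<phi>=\<phi> and \<psi>=\<psi>, OF fin that max \<beta>])
  have col: "(\<Sum>i\<in>I. \<pi> i j) = q j" if "j \<in> J" for j
  proof -
    have "(\<Sum>i\<in>I. \<beta> * max 0 (\<psi> j + \<phi> i - c i j)) = q j"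
      by (rule penalised_dual_max_marginal[where c="\<lambda>j i. c i j" and q=p and \<phi>=\<psi> and \<psi>=\<phi>, OF fin(2,1) that _ \<beta>])
         (simp only: max penalised_dual_swap[where I=I and J=J and p=p and q=q and c=c])
    then show ?thesis
      by (simp add: \<pi>_def add.commute)
  qed
  have "\<phi> i + \<psi> j \<le> c i j + \<kappa>" if ij: "i \<in> I" "j \<in> J" for i j
  proof -
    have "\<pi> i j \<le> p i"
      unfolding row[OF ij(1), symmetric] using ij fin \<pi>0 by (intro member_le_sum) auto
    also have "\<dots> \<le> 1"
      unfolding mass(1)[symmetric] using ij fin pos by (intro member_le_sum) (auto simp: less_imp_le)
    finally have "max 0 (\<phi> i + \<psi> j - c i j) \<le> \<kappa>"
      using \<kappa> by (simp add: \<pi>_def \<beta>_def field_simps)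
    then show ?thesis
      by simp
  qed
  moreover have "(\<Sum>i\<in>I. \<Sum>j\<in>J. \<pi> i j * c i j) \<le> (\<Sum>i\<in>I. \<phi> i * p i) + (\<Sum>j\<in>J. \<psi> j * q j)"
  proof -
    have "(\<Sum>i\<in>I. \<Sum>j\<in>J. \<pi> i j * c i j) \<le> (\<Sum>i\<in>I. \<Sum>j\<in>J. \<phi> i * \<pi> i j + \<psi> j * \<pi> i j)"
    proof (intro sum_mono)
      fix i j
      \<comment> \<open>Complementary slackness: mass sits only where the dual constraint is
        violated, and there the cost is below \<open>\<phi> i + \<psi> j\<close>; elsewhere both
        sides vanish.\<close>
      show "\<pi> i j * c i j \<le> \<phi> i * \<pi> i j + \<psi> j * \<pi> i j"
      proof (cases "\<phi> i + \<psi> j \<le> c i j")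
        case True
        then show ?thesis by (simp add: \<pi>_def)
      next
        case False
        then have "\<pi> i j * c i j \<le> \<pi> i j * (\<phi> i + \<psi> j)"
          using \<pi>0 by (intro mult_left_mono) auto
        then show ?thesis
          by (simp add: algebra_simps)
      qed
    qed
    also have "\<dots> = (\<Sum>i\<in>I. \<Sum>j\<in>J. \<phi> i * \<pi> i j) + (\<Sum>j\<in>J. \<Sum>i\<in>I. \<psi> j * \<pi> i j)"
      by (simp add: sum.distrib sum.swap[of _ J I])
    also have "\<dots> = (\<Sum>i\<in>I. \<phi> i * p i) + (\<Sum>j\<in>J. \<psi> j * q j)"
      by (simp add: row col cong: sum.cong flip: sum_distrib_left)
    finally show ?thesis .
  qed
  ultimately show ?thesis
    using \<pi>0 row col by (intro exI[of _ \<pi>] exI[of _ \<phi>] exI[of _ \<psi>]) blast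
qed

section \<open>Couplings with prescribed block masses\<close>

lemma sets_subset_if_id_measurable:
  assumes "(\<lambda>x. x) \<in> measurable M N" "space M = space N"
  shows "sets N \<subseteq> sets M"
proof
  fix A assume A: "A \<in> sets N"
  then have "(\<lambda>x. x) -` A \<inter> space M \<in> sets M"
    using assms(1) by (rule measurable_sets[rotated])
  moreover have "(\<lambda>x. x) -` A \<inter> space M = A"
    using sets.sets_into_space[OF A] assms(2) by auto
  ultimately show "A \<in> sets M"
    by simp
qed

text \<open>Each inclusion is measurability of the identity. One direction uses that a pair of Borel
  maps into second countable spaces is Borel.\<close>

lemma sets_pair_restrict_borel:
  fixes X :: "'a::second_countable_topology set" and Y :: "'b::second_countable_topology set"
  shows "sets (restrict_space borel X \<Otimes>\<^sub>M restrict_space borel Y) = sets (restrict_space borel (X \<times> Y))"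
proof (rule antisym; rule sets_subset_if_id_measurable)
  show "(\<lambda>x. x) \<in> restrict_space borel (X \<times> Y) \<rightarrow>\<^sub>M restrict_space borel X \<Otimes>\<^sub>M restrict_space borel Y"
    unfolding measurable_pair_iff comp_def measurable_restrict_space2_iff
    by (auto intro!: measurable_restrict_space1 borel_measurable_continuous_onI
        continuous_intros simp: space_restrict_space)
  have 1: "fst \<in> restrict_space borel X \<Otimes>\<^sub>M restrict_space borel Y \<rightarrow>\<^sub>M borel"
    by (rule measurable_compose[OF measurable_fst measurable_restrict_space1]) simp_all
  have 2: "snd \<in> restrict_space borel X \<Otimes>\<^sub>M restrict_space borel Y \<rightarrow>\<^sub>M borel"
    by (rule measurable_compose[OF measurable_snd measurable_restrict_space1]) simp_all
  show "(\<lambda>x. x) \<in> restrict_space borel X \<Otimes>\<^sub>M restrict_space borel Y \<rightarrow>\<^sub>M restrict_space borel (X \<times> Y)"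
    using borel_measurable_Pair[OF 1 2]
    by (intro measurable_restrict_space2) (auto simp: space_pair_measure space_restrict_space)
qed (auto simp: space_pair_measure space_restrict_space)

text \<open>The blocks carry total mass one, so what lies outside them is null. They need not cover
  the space, which allows null blocks to be discarded.\<close>

lemma emeasure_eq_sum_Int:
  assumes "prob_space M" "finite I" "disjoint_family_on A I" "\<And>i. i \<in> I \<Longrightarrow> A i \<in> sets M"
    "(\<Sum>i\<in>I. measure M (A i)) = 1" "E \<in> sets M"
  shows "(\<Sum>i\<in>I. emeasure M (E \<inter> A i)) = emeasure M E"
proof -
  interpret prob_space M by fact
  have "prob (\<Union>i\<in>I. A i) = 1"
    using assms finite_measure_finite_Union[of I A] by (auto simp: image_subset_iff)
  then have "AE x in M. x \<in> (\<Union>i\<in>I. A i)"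
    using assms by (intro AE_prob_1)
  then have "emeasure M E = emeasure M (\<Union>i\<in>I. E \<inter> A i)"
    using assms by (intro emeasure_eq_AE) (auto elim!: eventually_mono)
  also have "\<dots> = (\<Sum>i\<in>I. emeasure M (E \<inter> A i))"
    using assms by (intro sum_emeasure[symmetric]) (auto simp: disjoint_family_on_def)
  finally show ?thesis ..
qed

text \<open>The coupling has a density with respect to the product measure that is constant on each
  block \<open>A i \<times> B j\<close> and scaled to give it mass \<open>\<pi> i j\<close>. Within
  a block it is a multiple of the product, so the row and column sums give the marginals.\<close>

lemma block_coupling:
  assumes M: "prob_space M" and N: "prob_space N"
    and fin: "finite I" "finite J"
    and disj: "disjoint_family_on A I" "disjoint_family_on B J"
    and meas: "\<And>i. i \<in> I \<Longrightarrow> A i \<in> sets M" "\<And>j. j \<in> J \<Longrightarrow> B j \<in> sets N"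
    and pos: "\<And>i. i \<in> I \<Longrightarrow> 0 < measure M (A i)" "\<And>j. j \<in> J \<Longrightarrow> 0 < measure N (B j)"
    and mass: "(\<Sum>i\<in>I. measure M (A i)) = 1" "(\<Sum>j\<in>J. measure N (B j)) = 1"
    and \<pi>: "\<And>i j. (0::real) \<le> \<pi> i j"
    and row: "\<And>i. i \<in> I \<Longrightarrow> (\<Sum>j\<in>J. \<pi> i j) = measure M (A i)"
    and col: "\<And>j. j \<in> J \<Longrightarrow> (\<Sum>i\<in>I. \<pi> i j) = measure N (B j)"
  obtains \<rho> where "sets \<rho> = sets (M \<Otimes>\<^sub>M N)" "distr \<rho> M fst = M" "distr \<rho> N snd = N"
    "\<And>i j. i \<in> I \<Longrightarrow> j \<in> J \<Longrightarrow> emeasure \<rho> (A i \<times> B j) = ennreal (\<pi> i j)"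
proof -
  interpret M: prob_space M by fact
  interpret N: prob_space N by fact
  define k where "k i j = ennreal (\<pi> i j / (measure M (A i) * measure N (B j)))" for i j
  define w where "w z = (\<Sum>i\<in>I. \<Sum>j\<in>J. k i j * indicator (A i \<times> B j) z)" for z
  define \<rho> where "\<rho> = density (M \<Otimes>\<^sub>M N) w"
  have AB: "A i \<times> B j \<in> sets (M \<Otimes>\<^sub>M N)" if "i \<in> I" "j \<in> J" for i j
    using meas that by auto
  have w: "w \<in> borel_measurable (M \<Otimes>\<^sub>M N)"
    unfolding w_def using AB by (intro borel_measurable_sum borel_measurable_times_ennreal) auto
  \<comment> \<open>Both marginals and the block masses are instances of this formula for
    rectangles.\<close>
  have \<rho>: "emeasure \<rho> (E \<times> G) = (\<Sum>i\<in>I. \<Sum>j\<in>J. k i j * (emeasure M (E \<inter> A i) * emeasure N (G \<inter> B j)))"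
    if EG: "E \<in> sets M" "G \<in> sets N" for E G
  proof -
    have "emeasure \<rho> (E \<times> G) = (\<integral>\<^sup>+z. w z * indicator (E \<times> G) z \<partial>(M \<Otimes>\<^sub>M N))"
      unfolding \<rho>_def using EG w by (intro emeasure_density) auto
    also have "\<dots> = (\<integral>\<^sup>+z. (\<Sum>i\<in>I. \<Sum>j\<in>J. k i j * indicator ((E \<inter> A i) \<times> (G \<inter> B j)) z) \<partial>(M \<Otimes>\<^sub>M N))"
      unfolding w_def sum_distrib_right
      by (intro nn_integral_cong sum.cong) (auto split: split_indicator)
    also have "\<dots> = (\<Sum>i\<in>I. \<Sum>j\<in>J. \<integral>\<^sup>+z. k i j * indicator ((E \<inter> A i) \<times> (G \<inter> B j)) z \<partial>(M \<Otimes>\<^sub>M N))"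
    proof -
      have m: "(E \<inter> A i) \<times> (G \<inter> B j) \<in> sets (M \<Otimes>\<^sub>M N)" if "i \<in> I" "j \<in> J" for i j
        using EG meas that by auto
      have "(\<integral>\<^sup>+z. (\<Sum>i\<in>I. \<Sum>j\<in>J. k i j * indicator ((E \<inter> A i) \<times> (G \<inter> B j)) z) \<partial>(M \<Otimes>\<^sub>M N))
        = (\<Sum>i\<in>I. \<integral>\<^sup>+z. (\<Sum>j\<in>J. k i j * indicator ((E \<inter> A i) \<times> (G \<inter> B j)) z) \<partial>(M \<Otimes>\<^sub>M N))"
        using m by (intro nn_integral_sum borel_measurable_sum borel_measurable_times_ennreal) auto
      also have "\<dots> = (\<Sum>i\<in>I. \<Sum>j\<in>J. \<integral>\<^sup>+z. k i j * indicator ((E \<inter> A i) \<times> (G \<inter> B j)) z \<partial>(M \<Otimes>\<^sub>M N))"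
        using m by (intro sum.cong nn_integral_sum borel_measurable_times_ennreal) auto
      finally show ?thesis .
    qed
    also have "\<dots> = (\<Sum>i\<in>I. \<Sum>j\<in>J. k i j * (emeasure M (E \<inter> A i) * emeasure N (G \<inter> B j)))"
      using EG meas
      by (intro sum.cong refl)
        (subst nn_integral_cmult_indicator; auto simp: N.emeasure_pair_measure_Times)
    finally show ?thesis .
  qed
  have kAB: "k i j * (ennreal (measure M (A i)) * ennreal (measure N (B j))) = ennreal (\<pi> i j)"
    if "i \<in> I" "j \<in> J" for i j
    using pos(1)[OF that(1)] pos(2)[OF that(2)] \<pi>[of i j]
    by (simp add: k_def flip: ennreal_mult'')
  show thesis
  proof
    show sets: "sets \<rho> = sets (M \<Otimes>\<^sub>M N)"
      by (simp add: \<rho>_def)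
    show "distr \<rho> M fst = M"
    proof (rule measure_eqI)
      fix E assume "E \<in> sets (distr \<rho> M fst)"
      then have E: "E \<in> sets M" by simp
      have fst: "fst \<in> \<rho> \<rightarrow>\<^sub>M M"
        using sets by (simp cong: measurable_cong_sets)
      have "fst -` E \<inter> space \<rho> = E \<times> space N"
        using sets.sets_into_space[OF E] sets_eq_imp_space_eq[OF sets] by (auto simp: space_pair_measure)
      then have "emeasure (distr \<rho> M fst) E = emeasure \<rho> (E \<times> space N)"
        using E fst by (simp add: emeasure_distr)
      also have "\<dots> = (\<Sum>i\<in>I. \<Sum>j\<in>J. k i j * (emeasure M (E \<inter> A i) * emeasure N (B j)))"
        using E meas by (subst \<rho>) (auto intro!: sum.cong simp: Int_absorb1 sets.sets_into_space)
      also have "\<dots> = (\<Sum>i\<in>I. emeasure M (E \<inter> A i))"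
      proof (rule sum.cong)
        fix i assume i: "i \<in> I"
        have "(\<Sum>j\<in>J. k i j * (emeasure M (E \<inter> A i) * emeasure N (B j)))
          = (\<Sum>j\<in>J. ennreal (\<pi> i j / measure M (A i)) * emeasure M (E \<inter> A i))"
        proof (rule sum.cong)
          fix j assume j: "j \<in> J"
          have "k i j * emeasure N (B j) = ennreal (\<pi> i j / measure M (A i))"
            using pos(1)[OF i] pos(2)[OF j] \<pi>[of i j]
            by (simp add: k_def N.emeasure_eq_measure flip: ennreal_mult'')
          then show "k i j * (emeasure M (E \<inter> A i) * emeasure N (B j))
            = ennreal (\<pi> i j / measure M (A i)) * emeasure M (E \<inter> A i)"
            by (metis mult.assoc mult.commute)
        qed simp
        also have "\<dots> = ennreal (\<Sum>j\<in>J. \<pi> i j / measure M (A i)) * emeasure M (E \<inter> A i)"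
          using \<pi> pos(1)[OF i] by (simp add: sum_distrib_right sum_ennreal flip: sum_distrib_right)
        also have "(\<Sum>j\<in>J. \<pi> i j / measure M (A i)) = 1"
          using row[OF i] pos(1)[OF i] by (simp flip: sum_divide_distrib)
        finally show "(\<Sum>j\<in>J. k i j * (emeasure M (E \<inter> A i) * emeasure N (B j))) = emeasure M (E \<inter> A i)"
          by simp
      qed simp
      also have "\<dots> = emeasure M E"
        by (intro emeasure_eq_sum_Int M fin disj meas mass E)
      finally show "emeasure (distr \<rho> M fst) E = emeasure M E" .
    qed simp
    show "distr \<rho> N snd = N"
    proof (rule measure_eqI)
      fix G assume "G \<in> sets (distr \<rho> N snd)"
      then have G: "G \<in> sets N" by simp
      have snd: "snd \<in> \<rho> \<rightarrow>\<^sub>M N"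
        using sets by (simp cong: measurable_cong_sets)
      have "snd -` G \<inter> space \<rho> = space M \<times> G"
        using sets.sets_into_space[OF G] sets_eq_imp_space_eq[OF sets] by (auto simp: space_pair_measure)
      then have "emeasure (distr \<rho> N snd) G = emeasure \<rho> (space M \<times> G)"
        using G snd by (simp add: emeasure_distr)
      also have "\<dots> = (\<Sum>i\<in>I. \<Sum>j\<in>J. k i j * (emeasure M (A i) * emeasure N (G \<inter> B j)))"
        using G meas by (subst \<rho>) (auto intro!: sum.cong simp: Int_absorb1 sets.sets_into_space)
      also have "\<dots> = (\<Sum>j\<in>J. \<Sum>i\<in>I. k i j * (emeasure M (A i) * emeasure N (G \<inter> B j)))"
        by (rule sum.swap)
      also have "\<dots> = (\<Sum>j\<in>J. emeasure N (G \<inter> B j))"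
      proof (rule sum.cong)
        fix j assume j: "j \<in> J"
        have "(\<Sum>i\<in>I. k i j * (emeasure M (A i) * emeasure N (G \<inter> B j)))
          = (\<Sum>i\<in>I. ennreal (\<pi> i j / measure N (B j)) * emeasure N (G \<inter> B j))"
        proof (rule sum.cong)
          fix i assume i: "i \<in> I"
          have "k i j * emeasure M (A i) = ennreal (\<pi> i j / measure N (B j))"
            using pos(1)[OF i] pos(2)[OF j] \<pi>[of i j]
            by (simp add: k_def M.emeasure_eq_measure flip: ennreal_mult'')
          then show "k i j * (emeasure M (A i) * emeasure N (G \<inter> B j))
            = ennreal (\<pi> i j / measure N (B j)) * emeasure N (G \<inter> B j)"
            by (metis mult.assoc)
        qed simp
        also have "\<dots> = ennreal (\<Sum>i\<in>I. \<pi> i j / measure N (B j)) * emeasure N (G \<inter> B j)"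
          using \<pi> pos(2)[OF j] by (simp add: sum_distrib_right sum_ennreal flip: sum_distrib_right)
        also have "(\<Sum>i\<in>I. \<pi> i j / measure N (B j)) = 1"
          using col[OF j] pos(2)[OF j] by (simp flip: sum_divide_distrib)
        finally show "(\<Sum>i\<in>I. k i j * (emeasure M (A i) * emeasure N (G \<inter> B j))) = emeasure N (G \<inter> B j)"
          by simp
      qed simp
      also have "\<dots> = emeasure N G"
        by (intro emeasure_eq_sum_Int N fin disj meas mass G)
      finally show "emeasure (distr \<rho> N snd) G = emeasure N G" .
    qed simp
    fix i j assume ij: "i \<in> I" "j \<in> J"
    have "emeasure \<rho> (A i \<times> B j) =
      (\<Sum>i'\<in>I. \<Sum>j'\<in>J. k i' j' * (emeasure M (A i \<inter> A i') * emeasure N (B j \<inter> B j')))"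
      using ij meas by (intro \<rho>) auto
    also have "\<dots> = (\<Sum>i'\<in>I. if i' = i then (\<Sum>j'\<in>J. if j' = j then ennreal (\<pi> i j) else 0) else 0)"
    proof (intro sum.cong refl)
      fix i' assume i': "i' \<in> I"
      show "(\<Sum>j'\<in>J. k i' j' * (emeasure M (A i \<inter> A i') * emeasure N (B j \<inter> B j')))
        = (if i' = i then (\<Sum>j'\<in>J. if j' = j then ennreal (\<pi> i j) else 0) else 0)"
      proof (cases "i' = i")
        case True
        have "k i j' * (emeasure M (A i \<inter> A i) * emeasure N (B j \<inter> B j')) =
          (if j' = j then ennreal (\<pi> i j) else 0)" if "j' \<in> J" for j'
          using disj(2) ij that kAB[OF ij]
          by (auto simp: disjoint_family_on_def M.emeasure_eq_measure N.emeasure_eq_measure)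
        then show ?thesis
          using True by (auto intro!: sum.cong)
      next
        case False
        then have "A i \<inter> A i' = {}"
          using disj(1) ij i' by (auto simp: disjoint_family_on_def)
        then show ?thesis
          using False by simp
      qed
    qed
    also have "\<dots> = ennreal (\<pi> i j)"
      using ij fin by simp
    finally show "emeasure \<rho> (A i \<times> B j) = ennreal (\<pi> i j)" .
  qed
qed

section \<open>The Kantorovich--Rubinstein distance\<close>

lemma borel_probsD:
  assumes "m \<in> borel_probs S"
  shows "prob_space m" "sets m = sets (restrict_space borel S)" "space m = S"
  using assms sets_eq_imp_space_eq[of m "restrict_space borel S"]
  by (auto simp: borel_probs_def space_restrict_space)

lemma borel_measurable_borel_probs:
  assumes "m \<in> borel_probs S" "continuous_on S h"
  shows "h \<in> borel_measurable m"
  using borel_measurable_continuous_on_restrict[OF assms(2)] borel_probsD(2)[OF assms(1)]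
  by (simp cong: measurable_cong_sets)

lemma borel_probs_1D:
  assumes "m \<in> borel_probs_1 X"
  shows "m \<in> borel_probs X" "X \<noteq> {}"
  using assms by (auto simp: borel_probs_1_def)

lemma integrable_dist_borel_probs_1:
  assumes m: "m \<in> borel_probs_1 X"
  shows "integrable m (\<lambda>x. dist x z)"
proof -
  obtain x0 where x0: "(\<integral>\<^sup>+x. ennreal (dist x x0) \<partial>m) < \<infinity>"
    using m by (auto simp: borel_probs_1_def)
  interpret prob_space m
    using borel_probsD(1) borel_probs_1D(1)[OF m] .
  have meas: "(\<lambda>x. dist x y) \<in> borel_measurable m" for y
    by (intro borel_measurable_borel_probs[OF borel_probs_1D(1)[OF m]] continuous_intros)
  have "integrable m (\<lambda>x. dist x x0)"
    using x0 meas by (intro integrableI_bounded) (auto simp: less_top)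
  then have "integrable m (\<lambda>x. dist x x0 + dist x0 z)"
    by simp
  then show ?thesis
    by (rule Bochner_Integration.integrable_bound) (use meas in \<open>auto simp: dist_triangle\<close>)
qed

lemma integrable_lipschitz_borel_probs_1:
  fixes h :: "'a::metric_space \<Rightarrow> real"
  assumes m: "m \<in> borel_probs_1 X" and h: "K-lipschitz_on X h"
  shows "integrable m h"
proof -
  obtain x0 where x0: "x0 \<in> X"
    using borel_probs_1D(2)[OF m] by auto
  have X: "space m = X" and "prob_space m"
    using borel_probsD[OF borel_probs_1D(1)[OF m]] by auto
  interpret prob_space m by fact
  have "integrable m (\<lambda>x. \<bar>h x0\<bar> + K * dist x x0)"
    using integrable_dist_borel_probs_1[OF m] by simp
  then show ?thesis
  proof (rule Bochner_Integration.integrable_bound)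
    show "h \<in> borel_measurable m"
      by (intro borel_measurable_borel_probs[OF borel_probs_1D(1)[OF m]] lipschitz_on_continuous_on[OF h])
    have "\<bar>h x\<bar> \<le> \<bar>h x0\<bar> + K * dist x x0" if "x \<in> X" for x
      using lipschitz_onD[OF h that x0] by (simp add: dist_real_def)
    then show "AE x in m. norm (h x) \<le> norm (\<bar>h x0\<bar> + K * dist x x0)"
      unfolding X[symmetric] using lipschitz_on_nonneg[OF h] by (intro AE_I2) force
  qed
qed

text \<open>What has to be checked is that the supremum is over a bounded set: a 1-Lipschitz
  \<open>h\<close> differs from \<open>h x0\<close> by at most \<open>dist x x0\<close>, and
  \<open>h x0\<close> cancels because both measures have mass one.\<close>

lemma integral_diff_le_kr_dist:
  fixes h :: "'a::metric_space \<Rightarrow> real"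
  assumes m0: "m0 \<in> borel_probs_1 X" and m1: "m1 \<in> borel_probs_1 X" and h: "1-lipschitz_on X h"
  shows "(\<integral>x. h x \<partial>m0) - (\<integral>x. h x \<partial>m1) \<le> kr_dist X m0 m1"
  unfolding kr_dist_def
proof (rule cSUP_upper)
  obtain x0 where x0: "x0 \<in> X"
    using borel_probs_1D(2)[OF m0] by auto
  have X: "space m0 = X" "space m1 = X" and "prob_space m0" "prob_space m1"
    using borel_probsD[OF borel_probs_1D(1)[OF m0]] borel_probsD[OF borel_probs_1D(1)[OF m1]] by auto
  interpret m0: prob_space m0 by fact
  interpret m1: prob_space m1 by fact
  show "bdd_above ((\<lambda>h::'a \<Rightarrow> real. (\<integral>x. h x \<partial>m0) - (\<integral>x. h x \<partial>m1)) ` {h. 1-lipschitz_on X h})"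
  proof (rule bdd_aboveI2)
    fix h :: "'a \<Rightarrow> real" assume "h \<in> {h. 1-lipschitz_on X h}"
    then have h: "1-lipschitz_on X h" by simp
    have le: "h x \<le> h x0 + dist x x0" "h x0 - dist x x0 \<le> h x" if "x \<in> X" for x
      using lipschitz_onD[OF h that x0] by (auto simp: dist_real_def)
    have "(\<integral>x. h x \<partial>m0) \<le> (\<integral>x. h x0 + dist x x0 \<partial>m0)"
      using le X integrable_lipschitz_borel_probs_1[OF m0 h] integrable_dist_borel_probs_1[OF m0]
      by (intro integral_mono) auto
    also have "\<dots> = h x0 + (\<integral>x. dist x x0 \<partial>m0)"
      using integrable_dist_borel_probs_1[OF m0] by (simp add: m0.prob_space)
    finally have 1: "(\<integral>x. h x \<partial>m0) \<le> h x0 + (\<integral>x. dist x x0 \<partial>m0)" .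
    have "h x0 - (\<integral>x. dist x x0 \<partial>m1) = (\<integral>x. h x0 - dist x x0 \<partial>m1)"
      using integrable_dist_borel_probs_1[OF m1] by (simp add: m1.prob_space)
    also have "\<dots> \<le> (\<integral>x. h x \<partial>m1)"
      using le X integrable_lipschitz_borel_probs_1[OF m1 h] integrable_dist_borel_probs_1[OF m1]
      by (intro integral_mono) auto
    finally show "(\<integral>x. h x \<partial>m0) - (\<integral>x. h x \<partial>m1) \<le> (\<integral>x. dist x x0 \<partial>m0) + (\<integral>x. dist x x0 \<partial>m1)"
      using 1 by linarith
  qed
qed (use h in simp)

lemma kr_dist_nonneg:
  assumes "m0 \<in> borel_probs_1 X" "m1 \<in> borel_probs_1 X"
  shows "0 \<le> kr_dist X m0 m1"
  using integral_diff_le_kr_dist[OF assms, of "\<lambda>_. 0"] by (simp add: lipschitz_on_def)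

text \<open>The test functions are closed under negation, which exchanges the two integrals.\<close>

lemma kr_dist_commute: "kr_dist X m0 m1 = kr_dist X m1 m0"
proof -
  have "(\<lambda>h::'a \<Rightarrow> real. (\<integral>x. h x \<partial>m0) - (\<integral>x. h x \<partial>m1)) ` {h. 1-lipschitz_on X h}
    \<subseteq> (\<lambda>h. (\<integral>x. h x \<partial>m1) - (\<integral>x. h x \<partial>m0)) ` {h. 1-lipschitz_on X h}" for m0 m1 :: "'a measure"
  proof
    fix r assume "r \<in> (\<lambda>h::'a \<Rightarrow> real. (\<integral>x. h x \<partial>m0) - (\<integral>x. h x \<partial>m1)) ` {h. 1-lipschitz_on X h}"
    then obtain h :: "'a \<Rightarrow> real" where h: "1-lipschitz_on X h" "r = (\<integral>x. h x \<partial>m0) - (\<integral>x. h x \<partial>m1)"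
      by auto
    then show "r \<in> (\<lambda>h. (\<integral>x. h x \<partial>m1) - (\<integral>x. h x \<partial>m0)) ` {h. 1-lipschitz_on X h}"
      by (intro image_eqI[of _ _ "\<lambda>x. - h x"]) (auto simp: lipschitz_on_def dist_real_def abs_minus_commute)
  qed
  from this[of m0 m1] this[of m1 m0] show ?thesis
    unfolding kr_dist_def by (metis subset_antisym)
qed

lemma integral_diff_le_lipschitz_kr_dist:
  fixes h :: "'a::metric_space \<Rightarrow> real"
  assumes m0: "m0 \<in> borel_probs_1 X" and m1: "m1 \<in> borel_probs_1 X" and h: "K-lipschitz_on X h"
  shows "(\<integral>x. h x \<partial>m0) - (\<integral>x. h x \<partial>m1) \<le> K * kr_dist X m0 m1"
proof (cases "K = 0")
  \<comment> \<open>Rescaling by \<open>K\<close> is impossible here, but \<open>h\<close> is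
    constant on \<open>X\<close> and both integrals equal that constant.\<close>
  case True
  obtain x0 where x0: "x0 \<in> X"
    using borel_probs_1D(2)[OF m0] by auto
  have "(\<integral>x. h x \<partial>m) = h x0" if "m \<in> borel_probs_1 X" for m
  proof -
    have "space m = X" "prob_space m"
      using borel_probsD[OF borel_probs_1D(1)[OF that]] by auto
    then interpret prob_space m by simp
    have "h x = h x0" if "x \<in> X" for x
      using lipschitz_onD[OF h that x0] True by simp
    then have "(\<integral>x. h x \<partial>m) = (\<integral>x. h x0 \<partial>m)"
      using \<open>space m = X\<close> by (intro Bochner_Integration.integral_cong) auto
    then show ?thesis
      by (simp add: prob_space)
  qed
  then show ?thesis
    using m0 m1 True by simp
next
  case False
  then have K: "0 < K"
    using lipschitz_on_nonneg[OF h] by simp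
  have "1-lipschitz_on X (\<lambda>x. h x / K)"
  proof (rule lipschitz_onI)
    fix x y assume "x \<in> X" "y \<in> X"
    from lipschitz_onD[OF h this] show "dist (h x / K) (h y / K) \<le> 1 * dist x y"
      using K by (simp add: dist_real_def field_simps flip: diff_divide_distrib)
  qed simp
  from integral_diff_le_kr_dist[OF m0 m1 this] show ?thesis
    using K by (simp add: field_simps)
qed

section \<open>Simple approximation of measures and near-optimal couplings\<close>

lemma simple_function_sum_indicator:
  fixes h :: "'b \<Rightarrow> real"
  assumes "simple_function M T" "x \<in> space M"
  shows "h (T x) = (\<Sum>a\<in>T ` space M. h a * indicator (T -` {a} \<inter> space M) x)"
proof -
  have "(\<Sum>a\<in>T ` space M. h a * indicator (T -` {a} \<inter> space M) x) = (\<Sum>a\<in>T ` space M. if a = T x then h a else 0)"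
    using assms(2) by (intro sum.cong) (auto split: split_indicator)
  then show ?thesis
    using assms by (simp add: simple_function_def)
qed

lemma
  fixes h :: "'b \<Rightarrow> real"
  assumes M: "prob_space M" and T: "simple_function M T"
  shows integrable_comp_simple: "integrable M (\<lambda>x. h (T x))"
    and integral_comp_simple:
      "(\<integral>x. h (T x) \<partial>M) = (\<Sum>a\<in>T ` space M. h a * measure M (T -` {a} \<inter> space M))"
proof -
  interpret prob_space M by fact
  have int: "integrable M (\<lambda>x. h a * indicator (T -` {a} \<inter> space M) x)" for a
    using simple_functionD(2)[OF T, of "{a}"] by (intro integrable_mult_right integrable_real_indicator) (auto simp: less_top[symmetric])
  have "integrable M (\<lambda>x. \<Sum>a\<in>T ` space M. h a * indicator (T -` {a} \<inter> space M) x)"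
    using int by (intro Bochner_Integration.integrable_sum)
  then show "integrable M (\<lambda>x. h (T x))"
    by (simp add: simple_function_sum_indicator[OF T] cong: Bochner_Integration.integrable_cong)
  have "(\<integral>x. h (T x) \<partial>M) = (\<integral>x. (\<Sum>a\<in>T ` space M. h a * indicator (T -` {a} \<inter> space M) x) \<partial>M)"
    by (intro Bochner_Integration.integral_cong) (simp_all add: simple_function_sum_indicator[OF T])
  also have "\<dots> = (\<Sum>a\<in>T ` space M. h a * measure M (T -` {a} \<inter> space M))"
    using int simple_functionD(2)[OF T] by (subst Bochner_Integration.integral_sum) (auto intro!: sum.cong)
  finally show "(\<integral>x. h (T x) \<partial>M) = (\<Sum>a\<in>T ` space M. h a * measure M (T -` {a} \<inter> space M))" .
qed

text \<open>Simple maps converge pointwise to the identity while staying within twice the distance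
  to a base point, so dominated convergence applies with \<open>3 * dist x z\<close>. The sequence
  depends only on the Borel structure of \<open>X\<close>, hence one index serves both
  measures.\<close>

lemma simple_approximation_of_identity:
  fixes X :: "'a::{metric_space, second_countable_topology} set"
  assumes m0: "m0 \<in> borel_probs_1 X" and m1: "m1 \<in> borel_probs_1 X" and \<epsilon>: "0 < \<epsilon>"
  obtains T where "simple_function m0 T" "simple_function m1 T"
    "integrable m0 (\<lambda>x. dist x (T x))" "(\<integral>x. dist x (T x) \<partial>m0) < \<epsilon>"
    "integrable m1 (\<lambda>x. dist x (T x))" "(\<integral>x. dist x (T x) \<partial>m1) < \<epsilon>"
proof -
  fix z :: 'a
  let ?R = "restrict_space borel X"
  have id: "(\<lambda>x. x) \<in> borel_measurable ?R"
    by (intro borel_measurable_continuous_on_restrict continuous_intros)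
  obtain T where T: "\<And>i. simple_function ?R (T i)"
    and lim: "\<And>x. x \<in> X \<Longrightarrow> (\<lambda>i. T i x) \<longlonglongrightarrow> x"
    and le: "\<And>i x. x \<in> X \<Longrightarrow> dist (T i x) z \<le> 2 * dist x z"
    using borel_measurable_implies_sequence_metric[OF id, of z] by (simp add: space_restrict_space) metis
  have *: "simple_function m (T i) \<and> integrable m (\<lambda>x. dist x (T i x))"
    "(\<lambda>i. \<integral>x. dist x (T i x) \<partial>m) \<longlonglongrightarrow> 0" if m: "m \<in> borel_probs_1 X" for m i
  proof -
    note mP = borel_probsD[OF borel_probs_1D(1)[OF m]]
    have simple: "simple_function m (T i)" for i
      using T[of i] mP by (simp add: simple_function_cong_algebra[of m ?R] space_restrict_space)
    have id: "(\<lambda>x. x) \<in> borel_measurable m"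
      using id mP by (simp cong: measurable_cong_sets)
    have meas: "(\<lambda>x. dist x (T i x)) \<in> borel_measurable m" for i
      using id borel_measurable_simple_function[OF simple] by (intro borel_measurable_dist)
    have int: "integrable m (\<lambda>x. 3 * dist x z)"
      using integrable_dist_borel_probs_1[OF m] by simp
    have bound: "dist x (T i x) \<le> 3 * dist x z" if "x \<in> X" for x i
      using le[OF that, of i] dist_triangle2[of x "T i x" z] by simp
    have "(\<lambda>i. \<integral>x. dist x (T i x) \<partial>m) \<longlonglongrightarrow> (\<integral>x. 0 \<partial>m)"
    proof (rule integral_dominated_convergence[OF _ meas int])
      show "AE x in m. (\<lambda>i. dist x (T i x)) \<longlonglongrightarrow> 0"
      proof (rule AE_I2)
        fix x assume "x \<in> space m"
        then have "(\<lambda>i. T i x) \<longlonglongrightarrow> x"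
          using lim mP by simp
        from tendsto_dist[OF tendsto_const this, of x] show "(\<lambda>i. dist x (T i x)) \<longlonglongrightarrow> 0"
          by simp
      qed
    qed (use bound mP in auto)
    then show "(\<lambda>i. \<integral>x. dist x (T i x) \<partial>m) \<longlonglongrightarrow> 0"
      by simp
    have "integrable m (\<lambda>x. dist x (T i x))"
      by (rule Bochner_Integration.integrable_bound[OF int meas]) (use bound mP in auto)
    with simple show "simple_function m (T i) \<and> integrable m (\<lambda>x. dist x (T i x))"
      by simp
  qed
  have "\<forall>\<^sub>F i in sequentially. (\<integral>x. dist x (T i x) \<partial>m0) < \<epsilon> \<and> (\<integral>x. dist x (T i x) \<partial>m1) < \<epsilon>"
    using *(2)[OF m0] *(2)[OF m1] \<epsilon> by (intro eventually_conj order_tendstoD)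
  then obtain i where "(\<integral>x. dist x (T i x) \<partial>m0) < \<epsilon>" "(\<integral>x. dist x (T i x) \<partial>m1) < \<epsilon>"
    by (auto simp: eventually_sequentially)
  then show thesis
    using that[of "T i"] *(1)[OF m0, of i] *(1)[OF m1, of i] by blast
qed

text \<open>An index that is minimal at \<open>y\<close> is a competitor at \<open>x\<close>, at an
  extra cost of \<open>dist x y\<close>. The function is a c-transform for the distance
  cost.\<close>

lemma lipschitz_Min:
  fixes u :: "'b \<Rightarrow> real"
  assumes "finite J" "J \<noteq> {}"
  shows "1-lipschitz_on X (\<lambda>x::'a::metric_space. Min ((\<lambda>b. dist x (v b) - u b) ` J))"
proof (rule lipschitz_onI)
  have le: "Min ((\<lambda>b. dist x (v b) - u b) ` J) \<le> Min ((\<lambda>b. dist y (v b) - u b) ` J) + dist x y"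
    for x y :: 'a
  proof -
    obtain b where b: "b \<in> J" "Min ((\<lambda>b. dist y (v b) - u b) ` J) = dist y (v b) - u b"
      using Min_in[of "(\<lambda>b. dist y (v b) - u b) ` J"] assms by fastforce
    have "Min ((\<lambda>b. dist x (v b) - u b) ` J) \<le> dist x (v b) - u b"
      using b assms by (intro Min_le) auto
    also have "\<dots> \<le> dist y (v b) - u b + dist x y"
      using dist_triangle[of x "v b" y] by simp
    finally show ?thesis
      using b by simp
  qed
  fix x y
  show "dist (Min ((\<lambda>b. dist x (v b) - u b) ` J)) (Min ((\<lambda>b. dist y (v b) - u b) ` J)) \<le> 1 * dist x y"
    using le[of x y] le[of y x] by (simp add: dist_real_def dist_commute)
qed simp

text \<open>One half of the Kantorovich--Rubinstein duality theorem, up to \<open>\<epsilon>\<close>: both measures are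
  replaced by their images under a simple map close to the identity, and an optimal plan between
  the images is spread over the level sets of that map.\<close>

lemma near_optimal_coupling:
  fixes X :: "'a::{metric_space, second_countable_topology} set"
  assumes m0: "m0 \<in> borel_probs_1 X" and m1: "m1 \<in> borel_probs_1 X" and \<epsilon>: "0 < \<epsilon>"
  shows "\<exists>\<rho>\<in>couplings X m0 m1.
    (\<integral>\<^sup>+p. ennreal (dist (fst p) (snd p)) \<partial>\<rho>) \<le> ennreal (kr_dist X m0 m1 + \<epsilon>)"
proof -
  note P0 = borel_probsD[OF borel_probs_1D(1)[OF m0]] and P1 = borel_probsD[OF borel_probs_1D(1)[OF m1]]
  interpret m0: prob_space m0 by (rule P0)
  interpret m1: prob_space m1 by (rule P1)
  \<comment> \<open>Five errors are added up: the slack of the finite dual, and for each measure the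
    distance to its simple image twice, once in the potentials and once in the cost of the
    plan.\<close>
  have "0 < \<epsilon> / 5"
    using \<epsilon> by simp
  then obtain T where T0: "simple_function m0 T" and T1: "simple_function m1 T"
    and d0: "integrable m0 (\<lambda>x. dist x (T x))" "(\<integral>x. dist x (T x) \<partial>m0) < \<epsilon> / 5"
    and d1: "integrable m1 (\<lambda>x. dist x (T x))" "(\<integral>x. dist x (T x) \<partial>m1) < \<epsilon> / 5"
    using simple_approximation_of_identity[OF m0 m1] by metis
  define A where "A a = T -` {a} \<inter> X" for a
  \<comment> \<open>Finite duality and block couplings need positive masses, so values of
    \<open>T\<close> with null level sets are dropped, separately for each measure.\<close>
  define I where "I = {a \<in> T ` X. 0 < measure m0 (A a)}"
  define J where "J = {a \<in> T ` X. 0 < measure m1 (A a)}"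
  have finT: "finite (T ` X)"
    using T0 P0 by (simp add: simple_function_def)
  have fin: "finite I" "finite J"
    using finT by (auto simp: I_def J_def)
  have A0: "A a \<in> sets m0" and A1: "A a \<in> sets m1" for a
    using simple_functionD(2)[OF T0, of "{a}"] simple_functionD(2)[OF T1, of "{a}"] P0(3) P1(3)
    by (simp_all add: A_def)
  have int0: "(\<integral>x. h (T x) \<partial>m0) = (\<Sum>a\<in>I. h a * measure m0 (A a))" for h :: "'a \<Rightarrow> real"
    unfolding integral_comp_simple[OF P0(1) T0] P0(3) A_def[symmetric] using finT
    by (intro sum.mono_neutral_right) (auto simp: I_def zero_less_measure_iff)
  have int1: "(\<integral>x. h (T x) \<partial>m1) = (\<Sum>a\<in>J. h a * measure m1 (A a))" for h :: "'a \<Rightarrow> real"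
    unfolding integral_comp_simple[OF P1(1) T1] P1(3) A_def[symmetric] using finT
    by (intro sum.mono_neutral_right) (auto simp: J_def zero_less_measure_iff)
  have mass: "(\<Sum>a\<in>I. measure m0 (A a)) = 1" "(\<Sum>a\<in>J. measure m1 (A a)) = 1"
    using int0[of "\<lambda>_. 1"] int1[of "\<lambda>_. 1"] by (simp_all add: m0.prob_space m1.prob_space)
  then have neJ: "J \<noteq> {}"
    by auto
  have disj: "disjoint_family_on A K" for K
    by (auto simp: disjoint_family_on_def A_def)
  have "\<exists>\<pi> \<phi> \<psi>. (\<forall>i j. (0::real) \<le> \<pi> i j) \<and>
    (\<forall>i\<in>I. (\<Sum>j\<in>J. \<pi> i j) = measure m0 (A i)) \<and> (\<forall>j\<in>J. (\<Sum>i\<in>I. \<pi> i j) = measure m1 (A j)) \<and>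
    (\<forall>i\<in>I. \<forall>j\<in>J. \<phi> i + \<psi> j \<le> dist i j + \<epsilon> / 5) \<and>
    (\<Sum>i\<in>I. \<Sum>j\<in>J. \<pi> i j * dist i j) \<le> (\<Sum>i\<in>I. \<phi> i * measure m0 (A i)) + (\<Sum>j\<in>J. \<psi> j * measure m1 (A j))"
    (is "\<exists>\<pi> \<phi> \<psi>. ?P \<pi> \<phi> \<psi>")
    by (rule finite_transport_duality)
      (use fin mass \<epsilon> in \<open>auto simp: I_def J_def\<close>)
  then obtain \<pi> where "\<exists>\<phi> \<psi>. ?P \<pi> \<phi> \<psi>" by (rule exE)
  then obtain \<phi> where "\<exists>\<psi>. ?P \<pi> \<phi> \<psi>" by (rule exE)
  then obtain \<psi> where P: "?P \<pi> \<phi> \<psi>" by (rule exE)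
  have \<pi>: "\<And>i j. 0 \<le> \<pi> i j"
    and row: "\<And>i. i \<in> I \<Longrightarrow> (\<Sum>j\<in>J. \<pi> i j) = measure m0 (A i)"
    and col: "\<And>j. j \<in> J \<Longrightarrow> (\<Sum>i\<in>I. \<pi> i j) = measure m1 (A j)"
    and feas: "\<And>i j. i \<in> I \<Longrightarrow> j \<in> J \<Longrightarrow> \<phi> i + \<psi> j \<le> dist i j + \<epsilon> / 5"
    and cost: "(\<Sum>i\<in>I. \<Sum>j\<in>J. \<pi> i j * dist i j)
      \<le> (\<Sum>i\<in>I. \<phi> i * measure m0 (A i)) + (\<Sum>j\<in>J. \<psi> j * measure m1 (A j))"
    using P by simp_all
  \<comment> \<open>The c-transform of \<open>\<psi>\<close> replaces the pair of potentials by a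
    single 1-Lipschitz function: it lies above \<open>\<phi> - \<epsilon> / 5\<close> on
    \<open>I\<close> and below \<open>- \<psi>\<close> on \<open>J\<close>.\<close>
  define h where "h x = Min ((\<lambda>b. dist x b - \<psi> b) ` J)" for x
  have h: "1-lipschitz_on S h" for S
    unfolding h_def using lipschitz_Min[OF fin(2) neJ, of S "\<lambda>b. b" \<psi>] by simp
  have h\<phi>: "\<phi> a - \<epsilon> / 5 \<le> h a" if "a \<in> I" for a
    unfolding h_def using fin neJ feas[OF that] by (subst Min_ge_iff) (auto simp: algebra_simps)
  have h\<psi>: "h b \<le> - \<psi> b" if "b \<in> J" for b
    unfolding h_def using fin that by (intro Min.coboundedI) (auto intro!: image_eqI[of _ _ b])
  \<comment> \<open>Nothing forces \<open>T x\<close> to lie in \<open>X\<close>, so the Lipschitz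
    bound is taken on the whole space.\<close>
  have hT: "\<bar>h (T x) - h x\<bar> \<le> dist x (T x)" for x
    using lipschitz_onD[OF h[of UNIV], of "T x" x] by (simp add: dist_real_def dist_commute)
  have "(\<Sum>i\<in>I. \<phi> i * measure m0 (A i)) \<le> (\<Sum>i\<in>I. (h i + \<epsilon> / 5) * measure m0 (A i))"
    using h\<phi> by (intro sum_mono mult_right_mono) (auto simp: algebra_simps)
  also have "\<dots> = (\<integral>x. h (T x) \<partial>m0) + \<epsilon> / 5"
    by (simp add: int0 distrib_right sum.distrib mass flip: sum_divide_distrib sum_distrib_left)
  also have "(\<integral>x. h (T x) \<partial>m0) \<le> (\<integral>x. h x + dist x (T x) \<partial>m0)"
    using integrable_comp_simple[OF P0(1) T0, of h] integrable_lipschitz_borel_probs_1[OF m0 h] d0(1) hT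
    by (intro integral_mono) (auto simp: abs_le_iff algebra_simps)
  also have "\<dots> = (\<integral>x. h x \<partial>m0) + (\<integral>x. dist x (T x) \<partial>m0)"
    using integrable_lipschitz_borel_probs_1[OF m0 h] d0(1) by simp
  finally have 1: "(\<Sum>i\<in>I. \<phi> i * measure m0 (A i)) \<le> (\<integral>x. h x \<partial>m0) + 2 * \<epsilon> / 5"
    using d0(2) by simp
  have "(\<Sum>j\<in>J. \<psi> j * measure m1 (A j)) \<le> (\<Sum>j\<in>J. - h j * measure m1 (A j))"
    using h\<psi> by (intro sum_mono mult_right_mono) (auto simp: le_minus_iff)
  also have "\<dots> = - (\<integral>x. h (T x) \<partial>m1)"
    by (simp add: int1 sum_negf)
  also have "\<dots> \<le> - (\<integral>x. h x - dist x (T x) \<partial>m1)"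
    unfolding neg_le_iff_le
    using integrable_comp_simple[OF P1(1) T1, of h] integrable_lipschitz_borel_probs_1[OF m1 h] d1(1) hT
    by (intro integral_mono) (auto simp: abs_le_iff algebra_simps)
  also have "\<dots> = - (\<integral>x. h x \<partial>m1) + (\<integral>x. dist x (T x) \<partial>m1)"
    using integrable_lipschitz_borel_probs_1[OF m1 h] d1(1) by simp
  finally have 2: "(\<Sum>j\<in>J. \<psi> j * measure m1 (A j)) \<le> - (\<integral>x. h x \<partial>m1) + \<epsilon> / 5"
    using d1(2) by simp
  have cost': "(\<Sum>i\<in>I. \<Sum>j\<in>J. \<pi> i j * dist i j) \<le> kr_dist X m0 m1 + 3 * \<epsilon> / 5"
    using cost 1 2 integral_diff_le_kr_dist[OF m0 m1 h] by simp
  obtain \<rho> where sets: "sets \<rho> = sets (m0 \<Otimes>\<^sub>M m1)"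
    and fst: "distr \<rho> m0 fst = m0" and snd: "distr \<rho> m1 snd = m1"
    and block: "\<And>i j. i \<in> I \<Longrightarrow> j \<in> J \<Longrightarrow> emeasure \<rho> (A i \<times> A j) = ennreal (\<pi> i j)"
    using block_coupling[OF P0(1) P1(1) fin disj disj A0 A1 _ _ mass \<pi> row col]
    by (auto simp: I_def J_def)
  have sets': "sets \<rho> = sets (restrict_space borel (X \<times> X))"
    unfolding sets sets_pair_restrict_borel[symmetric] using P0(2) P1(2) by (intro sets_pair_measure_cong)
  have mfst: "fst \<in> \<rho> \<rightarrow>\<^sub>M m0" and msnd: "snd \<in> \<rho> \<rightarrow>\<^sub>M m1"
    using sets by (simp_all cong: measurable_cong_sets)
  have "emeasure \<rho> (space \<rho>) = emeasure (distr \<rho> m0 fst) (space m0)"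
    using mfst measurable_space[OF mfst] by (subst emeasure_distr) (auto intro!: arg_cong[where f="emeasure \<rho>"])
  then have "prob_space \<rho>"
    by (intro prob_spaceI) (simp add: fst m0.emeasure_space_1)
  \<comment> \<open>The marginals were formed with \<open>m0\<close> and \<open>m1\<close> as target
    spaces; these have the same measurable sets as the restricted Borel space.\<close>
  have coupling: "\<rho> \<in> couplings X m0 m1"
    using \<open>prob_space \<rho>\<close> sets' fst snd distr_cong[OF refl P0(2)[symmetric], of \<rho> fst fst]
      distr_cong[OF refl P1(2)[symmetric], of \<rho> snd snd]
    by (simp add: couplings_def borel_probs_def)
  \<comment> \<open>A step function that dominates \<open>dist (T (fst p)) (T (snd p))\<close>
    almost everywhere and whose integral is the cost of the finite plan.\<close>
  let ?C = "\<lambda>z. \<Sum>i\<in>I. \<Sum>j\<in>J. ennreal (dist i j) * indicator (A i \<times> A j) z"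
  have AA: "A i \<times> A j \<in> sets \<rho>" for i j
    using A0 A1 by (simp add: sets)
  have null0: "AE x in m0. T x \<in> I"
  proof -
    have "AE x in m0. \<forall>a\<in>T ` X - I. x \<notin> A a"
      using finT A0
      by (intro AE_finite_allI AE_not_in) (auto simp: I_def zero_less_measure_iff m0.emeasure_eq_measure intro!: null_setsI)
    then show ?thesis
      by (rule AE_mp[OF _ AE_I2]) (use P0 in \<open>auto simp: A_def\<close>)
  qed
  have null1: "AE x in m1. T x \<in> J"
  proof -
    have "AE x in m1. \<forall>a\<in>T ` X - J. x \<notin> A a"
      using finT A1
      by (intro AE_finite_allI AE_not_in) (auto simp: J_def zero_less_measure_iff m1.emeasure_eq_measure intro!: null_setsI)
    then show ?thesis
      by (rule AE_mp[OF _ AE_I2]) (use P1 in \<open>auto simp: A_def\<close>)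
  qed
  have AEs: "AE z in \<rho>. T (fst z) \<in> I" "AE z in \<rho>. T (snd z) \<in> J"
    by (rule AE_distrD[OF mfst], unfold fst, rule null0)
       (rule AE_distrD[OF msnd], unfold snd, rule null1)
  \<comment> \<open>Triangle inequality along the route from a point to its image under
    \<open>T\<close>, on to the image of the other point, and back to that point.\<close>
  have "(\<integral>\<^sup>+p. ennreal (dist (fst p) (snd p)) \<partial>\<rho>) \<le>
    (\<integral>\<^sup>+p. ennreal (dist (fst p) (T (fst p))) + (?C p + ennreal (dist (snd p) (T (snd p)))) \<partial>\<rho>)"
  proof (rule nn_integral_mono_AE)
    show "AE p in \<rho>. ennreal (dist (fst p) (snd p)) \<le>
      ennreal (dist (fst p) (T (fst p))) + (?C p + ennreal (dist (snd p) (T (snd p))))"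
      using AEs AE_space
    proof eventually_elim
      case (elim p)
      have "space \<rho> = X \<times> X"
        using sets_eq_imp_space_eq[OF sets'] by (simp add: space_restrict_space)
      then have X: "fst p \<in> X" "snd p \<in> X"
        using elim(3) by (simp_all only: mem_Times_iff)
      let ?i = "T (fst p)" and ?j = "T (snd p)"
      have "ennreal (dist ?i ?j) = ennreal (dist ?i ?j) * indicator (A ?i \<times> A ?j) p"
        using X by (cases p) (auto simp: A_def)
      also have "\<dots> \<le> (\<Sum>j\<in>J. ennreal (dist ?i j) * indicator (A ?i \<times> A j) p)"
        using elim fin by (intro member_le_sum[of ?j J "\<lambda>j. ennreal (dist ?i j) * indicator (A ?i \<times> A j) p"]) auto
      also have "\<dots> \<le> ?C p"
        using elim fin
        by (intro member_le_sum[of ?i I "\<lambda>i. \<Sum>j\<in>J. ennreal (dist i j) * indicator (A i \<times> A j) p"]) auto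
      finally have C: "ennreal (dist ?i ?j) \<le> ?C p" .
      have "dist (fst p) (snd p) \<le> dist (fst p) ?i + (dist ?i ?j + dist (snd p) ?j)"
        by (smt (verit) dist_commute dist_triangle)
      then have "ennreal (dist (fst p) (snd p)) \<le>
        ennreal (dist (fst p) ?i) + (ennreal (dist ?i ?j) + ennreal (dist (snd p) ?j))"
        by (simp flip: ennreal_plus)
      also have "\<dots> \<le> ennreal (dist (fst p) ?i) + (?C p + ennreal (dist (snd p) ?j))"
        using C by (intro add_left_mono add_right_mono)
      finally show ?case .
    qed
  qed
  also have "\<dots> = (\<integral>\<^sup>+p. ennreal (dist (fst p) (T (fst p))) \<partial>\<rho>) +
      ((\<integral>\<^sup>+p. ?C p \<partial>\<rho>) + (\<integral>\<^sup>+p. ennreal (dist (snd p) (T (snd p))) \<partial>\<rho>))"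
  proof -
    have "(\<lambda>p. ennreal (dist (fst p) (T (fst p)))) \<in> borel_measurable \<rho>"
      using measurable_compose[OF mfst borel_measurable_integrable[OF d0(1)]] by simp
    moreover have "(\<lambda>p. ennreal (dist (snd p) (T (snd p)))) \<in> borel_measurable \<rho>"
      using measurable_compose[OF msnd borel_measurable_integrable[OF d1(1)]] by simp
    moreover have "?C \<in> borel_measurable \<rho>"
      using AA by (intro borel_measurable_sum borel_measurable_times_ennreal) auto
    ultimately show ?thesis
      by (subst nn_integral_add; simp add: nn_integral_add)
  qed
  also have "(\<integral>\<^sup>+p. ennreal (dist (fst p) (T (fst p))) \<partial>\<rho>) = (\<integral>\<^sup>+x. ennreal (dist x (T x)) \<partial>m0)"
    using nn_integral_distr[OF mfst, of "\<lambda>x. ennreal (dist x (T x))"] borel_measurable_integrable[OF d0(1)]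
    by (simp add: fst)
  also have "(\<integral>\<^sup>+p. ennreal (dist (snd p) (T (snd p))) \<partial>\<rho>) = (\<integral>\<^sup>+x. ennreal (dist x (T x)) \<partial>m1)"
    using nn_integral_distr[OF msnd, of "\<lambda>x. ennreal (dist x (T x))"] borel_measurable_integrable[OF d1(1)]
    by (simp add: snd)
  also have "(\<integral>\<^sup>+p. ?C p \<partial>\<rho>) = ennreal (\<Sum>i\<in>I. \<Sum>j\<in>J. \<pi> i j * dist i j)"
  proof -
    have "(\<integral>\<^sup>+p. ?C p \<partial>\<rho>) = (\<Sum>i\<in>I. \<Sum>j\<in>J. \<integral>\<^sup>+p. ennreal (dist i j) * indicator (A i \<times> A j) p \<partial>\<rho>)"
      using AA by (subst nn_integral_sum borel_measurable_sum;
        auto intro!: borel_measurable_sum borel_measurable_times_ennreal sum.cong nn_integral_sum)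
    also have "\<dots> = (\<Sum>i\<in>I. \<Sum>j\<in>J. ennreal (\<pi> i j * dist i j))"
      using AA \<pi> by (intro sum.cong refl) (simp add: nn_integral_cmult_indicator block mult.commute flip: ennreal_mult)
    also have "\<dots> = ennreal (\<Sum>i\<in>I. \<Sum>j\<in>J. \<pi> i j * dist i j)"
      using \<pi> by (simp add: sum_ennreal sum_nonneg)
    finally show ?thesis .
  qed
  also have "(\<integral>\<^sup>+x. ennreal (dist x (T x)) \<partial>m0) = ennreal (\<integral>x. dist x (T x) \<partial>m0)"
    using d0(1) by (intro nn_integral_eq_integral) auto
  also have "(\<integral>\<^sup>+x. ennreal (dist x (T x)) \<partial>m1) = ennreal (\<integral>x. dist x (T x) \<partial>m1)"
    using d1(1) by (intro nn_integral_eq_integral) auto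
  also have "ennreal (\<integral>x. dist x (T x) \<partial>m0) + (ennreal (\<Sum>i\<in>I. \<Sum>j\<in>J. \<pi> i j * dist i j) + ennreal (\<integral>x. dist x (T x) \<partial>m1))
    = ennreal ((\<integral>x. dist x (T x) \<partial>m0) + ((\<Sum>i\<in>I. \<Sum>j\<in>J. \<pi> i j * dist i j) + (\<integral>x. dist x (T x) \<partial>m1)))"
    using \<pi> by (simp add: sum_nonneg flip: ennreal_plus)
  also have "\<dots> \<le> ennreal (kr_dist X m0 m1 + \<epsilon>)"
    using cost' d0(2) d1(2) by (intro ennreal_leI) simp
  finally show ?thesis
    using coupling by blast
qed

text \<open>An optimal plan is no more expensive than any near-optimal coupling, and the error of
  the latter is arbitrary.\<close>

lemma optimal_transport_cost_le_kr_dist: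
  fixes X :: "'a::{metric_space, second_countable_topology} set"
  assumes m0: "m0 \<in> borel_probs_1 X" and m1: "m1 \<in> borel_probs_1 X"
    and \<rho>: "optimal_transport X m0 m1 \<rho>"
  shows "(\<integral>\<^sup>+p. ennreal (dist (fst p) (snd p)) \<partial>\<rho>) \<le> ennreal (kr_dist X m0 m1)"
proof (rule ennreal_le_epsilon)
  fix e :: real assume "0 < e"
  then obtain \<rho>' where "\<rho>' \<in> couplings X m0 m1"
    "(\<integral>\<^sup>+p. ennreal (dist (fst p) (snd p)) \<partial>\<rho>') \<le> ennreal (kr_dist X m0 m1 + e)"
    using near_optimal_coupling[OF m0 m1] by blast
  then show "(\<integral>\<^sup>+p. ennreal (dist (fst p) (snd p)) \<partial>\<rho>) \<le> ennreal (kr_dist X m0 m1) + ennreal e"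
    using \<rho> kr_dist_nonneg[OF m0 m1] \<open>0 < e\<close>
    by (auto simp: optimal_transport_def simp flip: ennreal_plus intro: order_trans)
qed

section \<open>Measurable selections\<close>

text \<open>Cantor's intersection theorem: in a finite subfamily the set with the largest index lies
  in all the others.\<close>

lemma compact_decreasing_inter_nonempty:
  fixes K :: "nat \<Rightarrow> 'a::t2_space set"
  assumes "\<And>n. compact (K n)" "\<And>n. K n \<noteq> {}" "\<And>n. K (Suc n) \<subseteq> K n"
  shows "(\<Inter>n. K n) \<noteq> {}"
proof -
  have dec: "K n \<subseteq> K m" if "m \<le> n" for m n
    using lift_Suc_antimono_le[of K, OF assms(3) that] .
  have "K 0 \<inter> (\<Inter>n. K n) \<noteq> {}"
  proof (rule compact_imp_fip_image[OF assms(1)])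
    fix I :: "nat set" assume I: "finite I"
    \<comment> \<open>Inserting \<open>0\<close> makes the maximum meaningful for empty
      \<open>I\<close> and brings \<open>K 0\<close> under the same bound.\<close>
    define N where "N = Max (insert 0 I)"
    have "n \<le> N" if "n \<in> insert 0 I" for n
      using I that unfolding N_def by (intro Max_ge) auto
    then have "K N \<subseteq> K 0 \<inter> (\<Inter>n\<in>I. K n)"
      using dec by blast
    then show "K 0 \<inter> (\<Inter>n\<in>I. K n) \<noteq> {}"
      using assms(2)[of N] by blast
  qed (intro compact_imp_closed assms(1))
  then show ?thesis
    by auto
qed

text \<open>Each stage is cut down to the first ball of radius \<open>(1 / 2) ^ n\<close>, along the
  sequence of centres \<open>d\<close>, that meets it. For a dense sequence and non-empty compact
  values the stages shrink to a single point.\<close>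

primrec shrink ::
    "(nat \<Rightarrow> 'b::metric_space) \<Rightarrow> ('a \<Rightarrow> 'b set) \<Rightarrow> nat \<Rightarrow> 'a \<Rightarrow> 'b set" where
  "shrink d \<Phi> 0 x = \<Phi> x"
| "shrink d \<Phi> (Suc n) x = shrink d \<Phi> n x \<inter>
    cball (d (LEAST k. shrink d \<Phi> n x \<inter> cball (d k) ((1 / 2) ^ n) \<noteq> {})) ((1 / 2) ^ n)"

text \<open>A compact-valued form of the Kuratowski--Ryll-Nardzewski theorem. The least index of a
  ball depends measurably on \<open>x\<close>, so measurability of hitting sets survives every stage
  of \<open>shrink\<close>; compactness leaves exactly one point in the intersection, and that point
  is selected.\<close>

lemma compact_valued_measurable_selection:
  fixes \<Phi> :: "'a \<Rightarrow> 'b::{metric_space, second_countable_topology} set"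
  assumes compact: "\<And>x. x \<in> space M \<Longrightarrow> compact (\<Phi> x)"
    and nonempty: "\<And>x. x \<in> space M \<Longrightarrow> \<Phi> x \<noteq> {}"
    and meas: "\<And>C. closed C \<Longrightarrow> {x \<in> space M. \<Phi> x \<inter> C \<noteq> {}} \<in> sets M"
  shows "\<exists>s\<in>borel_measurable M. \<forall>x\<in>space M. s x \<in> \<Phi> x"
proof -
  obtain D :: "'b set" where D: "countable D" "\<And>U. open U \<Longrightarrow> U \<noteq> {} \<Longrightarrow> \<exists>d\<in>D. d \<in> U"
    by (erule countable_dense_setE)
  define d where "d = from_nat_into D"
  have "D \<noteq> {}"
    using D(2)[of UNIV] by auto
  have dense: "\<exists>k. dist (d k) y \<le> e" if "0 < e" for y e
  proof -
    obtain z where "z \<in> D" "z \<in> ball y e"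
      using D(2)[of "ball y e"] \<open>0 < e\<close> by (metis ball_eq_empty not_le open_ball)
    moreover obtain k where "d k = z"
      using from_nat_into_surj[OF D(1) \<open>z \<in> D\<close>] by (auto simp: d_def)
    ultimately show ?thesis
      by (auto intro!: exI[of _ k] simp: dist_commute)
  qed
  define \<Psi> where "\<Psi> = shrink d \<Phi>"
  define P where "P n k x \<longleftrightarrow> \<Psi> n x \<inter> cball (d k) ((1 / 2) ^ n) \<noteq> {}" for n k x
  have \<Psi>0: "\<Psi> 0 x = \<Phi> x" for x
    by (simp add: \<Psi>_def)
  have \<Psi>Suc: "\<Psi> (Suc n) x = \<Psi> n x \<inter> cball (d (LEAST k. P n k x)) ((1 / 2) ^ n)" for n x
    by (simp add: \<Psi>_def P_def)
  have exP: "\<exists>k. P n k x" if "\<Psi> n x \<noteq> {}" for n x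
  proof -
    obtain y where "y \<in> \<Psi> n x"
      using \<open>\<Psi> n x \<noteq> {}\<close> by auto
    moreover obtain k where "dist (d k) y \<le> (1 / 2) ^ n"
      using dense[of "(1 / 2) ^ n" y] by auto
    ultimately show ?thesis
      unfolding P_def by (intro exI[of _ k]) auto
  qed
  have ne: "\<Psi> n x \<noteq> {}" if "x \<in> space M" for n x
  proof (induction n)
    case (Suc n)
    then show ?case
      using LeastI_ex[OF exP[OF Suc]] by (simp add: \<Psi>Suc P_def)
  qed (use nonempty that \<Psi>0 in auto)
  have cpt: "compact (\<Psi> n x)" if "x \<in> space M" for n x
    by (induction n) (use compact that in \<open>auto simp: \<Psi>0 \<Psi>Suc compact_Int_closed\<close>)
  have mono: "\<Psi> (Suc n) x \<subseteq> \<Psi> n x" for n x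
    by (simp add: \<Psi>Suc)
  \<comment> \<open>The induction runs over all closed \<open>C\<close> at once, because the next
    stage meets \<open>C\<close> exactly when the current one meets \<open>C\<close> intersected
    with a ball.\<close>
  have meas_n: "{x \<in> space M. \<Psi> n x \<inter> C \<noteq> {}} \<in> sets M" if "closed C" for n C
    using that
  proof (induction n arbitrary: C)
    case 0
    then show ?case using meas by (simp add: \<Psi>0)
  next
    case (Suc n)
    have P[measurable]: "{x \<in> space M. P n k x} \<in> sets M" for k
      unfolding P_def by (rule Suc.IH) simp
    have [measurable]: "{x \<in> space M. \<Psi> n x \<inter> (cball (d k) ((1 / 2) ^ n) \<inter> C) \<noteq> {}} \<in> sets M" for k
      using Suc by auto
    \<comment> \<open>Splitting by the value \<open>k\<close> of the least index replaces the choice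
      by a countable union of measurable conditions.\<close>
    have "{x \<in> space M. \<Psi> (Suc n) x \<inter> C \<noteq> {}} =
      {x \<in> space M. \<exists>k. P n k x \<and> (\<forall>j<k. \<not> P n j x) \<and> \<Psi> n x \<inter> (cball (d k) ((1 / 2) ^ n) \<inter> C) \<noteq> {}}"
    proof (rule Collect_cong, rule conj_cong[OF refl])
      fix x assume x: "x \<in> space M"
      have "P n (LEAST k. P n k x) x"
        by (rule LeastI_ex[OF exP[OF ne[OF x]]])
      moreover have "(LEAST k. P n k x) = k" if "P n k x" "\<forall>j<k. \<not> P n j x" for k
        using that by (intro Least_equality) (auto simp: not_less[symmetric])
      ultimately show "\<Psi> (Suc n) x \<inter> C \<noteq> {} \<longleftrightarrow>
        (\<exists>k. P n k x \<and> (\<forall>j<k. \<not> P n j x) \<and> \<Psi> n x \<inter> (cball (d k) ((1 / 2) ^ n) \<inter> C) \<noteq> {})"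
        unfolding \<Psi>Suc Int_assoc using not_less_Least[of _ "\<lambda>k. P n k x"] by metis
    qed
    also have "\<dots> \<in> sets M"
      by measurable
    finally show ?case .
  qed
  define s where "s x = (SOME y. y \<in> (\<Inter>n. \<Psi> n x))" for x
  have s: "s x \<in> \<Psi> n x" if "x \<in> space M" for x n
    using some_in_eq[of "\<Inter>n. \<Psi> n x"]
      compact_decreasing_inter_nonempty[of "\<lambda>n. \<Psi> n x", OF cpt[OF that] ne[OF that] mono]
    unfolding s_def by blast
  \<comment> \<open>Two points that survive all stages share a ball of radius
    \<open>(1 / 2) ^ n\<close> for every \<open>n\<close>.\<close>
  have unique: "y = s x" if x: "x \<in> space M" and y: "\<And>n. y \<in> \<Psi> n x" for x y
  proof -
    have "dist y (s x) \<le> 2 * (1 / 2) ^ n" for n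
    proof -
      let ?c = "d (LEAST k. P n k x)"
      have "dist ?c y \<le> (1 / 2) ^ n" "dist ?c (s x) \<le> (1 / 2) ^ n"
        using y[of "Suc n"] s[OF x, of "Suc n"] by (auto simp: \<Psi>Suc)
      then show ?thesis
        using dist_triangle3[of y "s x" ?c] by linarith
    qed
    moreover have "(\<lambda>n. 2 * (1 / 2) ^ n :: real) \<longlonglongrightarrow> 2 * 0"
      by (intro tendsto_mult_left LIMSEQ_realpow_zero) auto
    ultimately have "dist y (s x) \<le> 2 * 0"
      by (meson LIMSEQ_le_const)
    then show ?thesis by simp
  qed
  have "s \<in> borel_measurable M"
  proof (rule borel_measurableI)
    fix U :: "'b set" assume "open U"
    \<comment> \<open>If every stage meets the closed set \<open>- U\<close>, compactness gives a
      point of \<open>- U\<close> in all stages, and this point can only be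
      \<open>s x\<close>.\<close>
    have "s x \<in> - U \<longleftrightarrow> (\<forall>n. \<Psi> n x \<inter> - U \<noteq> {})" if x: "x \<in> space M" for x
    proof
      assume "s x \<in> - U"
      then show "\<forall>n. \<Psi> n x \<inter> - U \<noteq> {}"
        using s[OF x] by blast
    next
      assume "\<forall>n. \<Psi> n x \<inter> - U \<noteq> {}"
      then have "(\<Inter>n. \<Psi> n x \<inter> - U) \<noteq> {}"
        using cpt[OF x] \<open>open U\<close>
        by (intro compact_decreasing_inter_nonempty Int_mono mono) (auto intro!: compact_Int_closed)
      then obtain y where "y \<in> - U" "\<And>n. y \<in> \<Psi> n x"
        by auto
      then show "s x \<in> - U"
        using unique[OF x, of y] by auto
    qed
    then have "s -` U \<inter> space M = space M - (\<Inter>n. {x \<in> space M. \<Psi> n x \<inter> - U \<noteq> {}})"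
      by auto
    also have "\<dots> \<in> sets M"
      using meas_n[of "- U"] \<open>open U\<close> by (intro sets.Diff sets.countable_INT) auto
    finally show "s -` U \<inter> space M \<in> sets M" .
  qed
  moreover have "\<forall>x\<in>space M. s x \<in> \<Phi> x"
    using s[of _ 0] \<Psi>0 by auto
  ultimately show ?thesis
    by blast
qed

text \<open>The tube lemma: if \<open>{x} \<times> F x\<close> misses \<open>E\<close>, compactness
  of \<open>F x\<close> gives a product neighbourhood \<open>U \<times> V\<close> missing
  \<open>E\<close>, and upper semi-continuity keeps the nearby values of \<open>F\<close> inside
  \<open>V\<close>.\<close>

lemma closed_usc_hitting_set:
  fixes X :: "'a::metric_space set" and F :: "'a \<Rightarrow> 'b::metric_space set"
  assumes X: "closed X" and usc: "svm_usc_on X F" and compact: "\<And>x. x \<in> X \<Longrightarrow> compact (F x)"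
    and E: "closed E"
  shows "closed {x \<in> X. \<exists>y\<in>F x. (x, y) \<in> E}"
  unfolding closed_def open_contains_ball
proof
  fix x assume x: "x \<in> - {x \<in> X. \<exists>y\<in>F x. (x, y) \<in> E}"
  show "\<exists>e>0. ball x e \<subseteq> - {x \<in> X. \<exists>y\<in>F x. (x, y) \<in> E}"
  proof (cases "x \<in> X")
    case False
    then obtain e where "0 < e" "ball x e \<subseteq> - X"
      using X open_contains_ball[of "- X"] by (auto simp: closed_def)
    then show ?thesis
      by (intro exI[of _ e]) auto
  next
    case True
    have "compactin euclidean {x}" "compactin euclidean (F x)"
      "openin (prod_topology euclidean euclidean) (- E)" "{x} \<times> F x \<subseteq> - E"
      using compact[OF True] x True E by (auto simp: closed_def simp flip: euclidean_product_topology)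
    then obtain U V where "openin euclidean U" "openin euclidean V" "{x} \<subseteq> U" "F x \<subseteq> V" "U \<times> V \<subseteq> - E"
      by (rule Wallace_theorem_prod_topology)
    then have UV: "open U" "open V" "x \<in> U" "F x \<subseteq> interior V" "U \<times> V \<subseteq> - E"
      by (auto simp: interior_open)
    obtain e where e: "0 < e" "ball x e \<subseteq> U"
      using UV open_contains_ball by blast
    obtain \<eta> where \<eta>: "0 < \<eta>" "\<And>x'. x' \<in> X \<Longrightarrow> dist x x' \<le> \<eta> \<Longrightarrow> F x' \<subseteq> V"
      using usc True UV(4) unfolding svm_usc_on_def by blast
    have "ball x (min e \<eta>) \<subseteq> - {x \<in> X. \<exists>y\<in>F x. (x, y) \<in> E}"
    proof (intro subsetI ComplI)
      fix x' assume x': "x' \<in> ball x (min e \<eta>)" "x' \<in> {x \<in> X. \<exists>y\<in>F x. (x, y) \<in> E}"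
      then obtain y where y: "x' \<in> X" "y \<in> F x'" "(x', y) \<in> E"
        by auto
      have "x' \<in> U" "y \<in> V"
        using x'(1) e(2) \<eta>(2)[OF y(1)] y(2) by auto
      then show False
        using UV(5) y(3) by auto
    qed
    then show ?thesis
      using e(1) \<eta>(1) by (intro exI[of _ "min e \<eta>"]) auto
  qed
qed

text \<open>Slices of the closed set \<open>E\<close> keep the values compact, and meeting a closed
  \<open>C\<close> amounts to hitting \<open>E \<inter> (UNIV \<times> C)\<close>, a closed
  condition on \<open>x\<close>. The set \<open>E\<close> makes room for an optimality constraint on
  the selection.\<close>

lemma usc_measurable_selection:
  fixes X :: "'a::metric_space set" and F :: "'a \<Rightarrow> 'b::{metric_space, second_countable_topology} set"
  assumes X: "closed X" and usc: "svm_usc_on X F" and compact: "\<And>x. x \<in> X \<Longrightarrow> compact (F x)"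
    and E: "closed E" and nonempty: "\<And>x. x \<in> X \<Longrightarrow> \<exists>y\<in>F x. (x, y) \<in> E"
  shows "\<exists>s\<in>borel_measurable (restrict_space borel X). \<forall>x\<in>X. s x \<in> F x \<and> (x, s x) \<in> E"
proof -
  let ?\<Phi> = "\<lambda>x. F x \<inter> Pair x -` E"
  have "\<exists>s\<in>borel_measurable (restrict_space borel X). \<forall>x\<in>space (restrict_space borel X). s x \<in> ?\<Phi> x"
  proof (rule compact_valued_measurable_selection)
    fix x assume "x \<in> space (restrict_space borel X)"
    then have x: "x \<in> X"
      by (simp add: space_restrict_space)
    have "closed (Pair x -` E)"
      using E by (intro closed_vimage continuous_intros)
    then show "compact (?\<Phi> x)"
      using compact[OF x] by (rule compact_Int_closed[rotated])
    show "?\<Phi> x \<noteq> {}"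
      using nonempty[OF x] by auto
  next
    fix C :: "'b set" assume C: "closed C"
    have "closed {x \<in> X. \<exists>y\<in>F x. (x, y) \<in> E \<inter> (UNIV \<times> C)}"
      using E C by (intro closed_usc_hitting_set X usc compact closed_Int closed_Times) auto
    moreover have "{x \<in> space (restrict_space borel X). ?\<Phi> x \<inter> C \<noteq> {}}
        = X \<inter> {x \<in> X. \<exists>y\<in>F x. (x, y) \<in> E \<inter> (UNIV \<times> C)}"
      by (auto simp: space_restrict_space)
    ultimately show "{x \<in> space (restrict_space borel X). ?\<Phi> x \<inter> C \<noteq> {}} \<in> sets (restrict_space borel X)"
      unfolding sets_restrict_space by (auto intro!: imageI borel_closed)
  qed
  then show ?thesis
    by (auto simp: space_restrict_space)
qed

section \<open>Near minimisers\<close>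

text \<open>Reduction to the one-dimensional tangent inequality on the line through \<open>u\<close>
  and \<open>v\<close>.\<close>

lemma convex_gradient_above_tangent:
  fixes f :: "'h::real_inner \<Rightarrow> real"
  assumes f: "convex_on UNIV f" and d: "GDERIV f u :> d"
  shows "f u + inner d (v - u) \<le> f v"
proof -
  define \<phi> where "\<phi> t = f (u + t *\<^sub>R (v - u))" for t
  have "convex_on UNIV \<phi>"
  proof (rule convex_onI)
    fix t x y :: real assume "0 < t" "t < 1"
    moreover have "u + ((1 - t) *\<^sub>R x + t *\<^sub>R y) *\<^sub>R (v - u) =
        (1 - t) *\<^sub>R (u + x *\<^sub>R (v - u)) + t *\<^sub>R (u + y *\<^sub>R (v - u))"
      by (simp add: algebra_simps)
    ultimately show "\<phi> ((1 - t) *\<^sub>R x + t *\<^sub>R y) \<le> (1 - t) * \<phi> x + t * \<phi> y"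
      unfolding \<phi>_def using convex_onD[OF f, of t "u + x *\<^sub>R (v - u)" "u + y *\<^sub>R (v - u)"] by simp
  qed simp
  moreover have "(\<phi> has_field_derivative inner d (v - u)) (at 0)"
  proof -
    have "(f has_derivative (\<lambda>h. inner h d)) (at (u + 0 *\<^sub>R (v - u)))"
      using d by (simp add: gderiv_def)
    moreover have "((\<lambda>t. u + t *\<^sub>R (v - u)) has_derivative (\<lambda>t. t *\<^sub>R (v - u))) (at 0)"
      by (auto intro!: derivative_eq_intros)
    ultimately have "(\<phi> has_derivative (\<lambda>t. inner (t *\<^sub>R (v - u)) d)) (at 0)"
      unfolding \<phi>_def by (rule has_derivative_compose[rotated])
    moreover have "(\<lambda>t. inner (t *\<^sub>R (v - u)) d) = (*) (inner d (v - u))"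
      by (auto simp: inner_commute)
    ultimately show ?thesis
      by (simp add: has_field_derivative_def)
  qed
  ultimately have "inner d (v - u) * (1 - 0) \<le> \<phi> 1 - \<phi> 0"
    by (intro convex_on_imp_above_tangent[of UNIV]) auto
  then show ?thesis
    by (simp add: \<phi>_def)
qed

text \<open>Convexity bounds the increment by the gradient at the far end, and the Lipschitz
  condition moves this gradient back to \<open>u\<close>. No integral along the segment is involved,
  at the price of \<open>L\<close> instead of \<open>L / 2\<close>.\<close>

lemma convex_lipschitz_gradient_upper_bound:
  fixes f :: "'h::real_inner \<Rightarrow> real"
  assumes f: "convex_on UNIV f" and grad: "\<And>u. GDERIV f u :> f' u" and lip: "L-lipschitz_on UNIV f'"
  shows "f (u + w) \<le> f u + inner (f' u) w + L * (norm w)\<^sup>2"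
proof -
  have "f (u + w) \<le> f u + inner (f' (u + w)) w"
    using convex_gradient_above_tangent[OF f grad, of "u + w" u] by simp
  also have "inner (f' (u + w)) w = inner (f' u) w + inner (f' (u + w) - f' u) w"
    by (simp add: inner_diff_left)
  also have "inner (f' (u + w) - f' u) w \<le> norm (f' (u + w) - f' u) * norm w"
    by (rule norm_cauchy_schwarz)
  also have "\<dots> \<le> (L * norm w) * norm w"
    using lipschitz_onD[OF lip, of "u + w" u] by (intro mult_right_mono) (auto simp: dist_norm)
  finally show ?thesis
    by (simp add: power2_eq_square mult.assoc)
qed

text \<open>The tolerance is \<open>\<delta>^2\<close> so that, after division by the step length
  \<open>\<delta>\<close>, both it and the quadratic error leave a remainder of order
  \<open>\<delta>\<close>.\<close>

lemma near_minimiser_first_order: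
  fixes f :: "'h::real_inner \<Rightarrow> real"
  assumes f: "convex_on UNIV f" and grad: "\<And>u. GDERIV f u :> f' u" and lip: "L-lipschitz_on UNIV f'"
    and \<delta>: "0 < \<delta>" and near: "f u \<le> f (u + \<delta> *\<^sub>R (v - u)) + \<delta>\<^sup>2" and D: "norm (v - u) \<le> D"
  shows "- \<delta> * (1 + L * D\<^sup>2) \<le> inner (f' u) (v - u)"
proof -
  have "f (u + \<delta> *\<^sub>R (v - u)) \<le> f u + \<delta> * inner (f' u) (v - u) + L * (\<delta> * norm (v - u))\<^sup>2"
    using convex_lipschitz_gradient_upper_bound[OF f grad lip, of u "\<delta> *\<^sub>R (v - u)"] \<delta> by simp
  also have "L * (\<delta> * norm (v - u))\<^sup>2 \<le> L * (\<delta> * D)\<^sup>2"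
    using D \<delta> lipschitz_on_nonneg[OF lip] by (intro mult_left_mono power_mono) auto
  finally have "\<delta> * 0 \<le> \<delta> * (inner (f' u) (v - u) + \<delta> * (1 + L * D\<^sup>2))"
    using near by (simp add: power2_eq_square algebra_simps)
  then have "0 \<le> inner (f' u) (v - u) + \<delta> * (1 + L * D\<^sup>2)"
    using \<delta> by (subst (asm) mult_le_cancel_left_pos)
  then show ?thesis
    by simp
qed

section \<open>Admissible measures and their mixtures\<close>

lemma fst_measurable_graph_on:
  "fst \<in> restrict_space borel (graph_on X F) \<rightarrow>\<^sub>M restrict_space borel X"
  by (intro measurable_restrict_space3 borel_measurable_continuous_onI continuous_intros)
     (auto simp: graph_on_def)

lemma admissibleD:
  assumes "\<mu> \<in> admissible X Z m"
  shows "\<mu> \<in> borel_probs Z" "distr \<mu> (restrict_space borel X) fst = m"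
  using assms by (auto simp: admissible_def)

lemma integrable_borel_probs_bounded:
  fixes g :: "'a::topological_space \<Rightarrow> 'h::{banach, second_countable_topology}"
  assumes "\<mu> \<in> borel_probs Z" "continuous_on Z g" "\<And>z. z \<in> Z \<Longrightarrow> norm (g z) \<le> B"
  shows "integrable \<mu> g" "norm (\<integral>z. g z \<partial>\<mu>) \<le> B"
proof -
  interpret prob_space \<mu>
    by (rule borel_probsD(1)[OF assms(1)])
  have bound: "AE z in \<mu>. norm (g z) \<le> B"
    using assms borel_probsD(3)[OF assms(1)] by (intro AE_I2) simp
  show int: "integrable \<mu> g"
    using bound borel_measurable_borel_probs[OF assms(1,2)]
    by (intro integrable_const_bound) auto
  have "norm (\<integral>z. g z \<partial>\<mu>) \<le> (\<integral>z. norm (g z) \<partial>\<mu>)"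
    by (rule integral_norm_bound)
  also have "\<dots> \<le> (\<integral>z. B \<partial>\<mu>)"
    using bound int by (intro integral_mono_AE) auto
  finally show "norm (\<integral>z. g z \<partial>\<mu>) \<le> B"
    by (simp add: prob_space)
qed

text \<open>The mixture \<open>(1 - t) \<mu> + t \<nu>\<close> is realised as a draw from \<open>\<nu>\<close> or \<open>\<mu>\<close> decided by a Bernoulli
  variable.\<close>

lemma admissible_mixture:
  fixes g :: "'x::topological_space \<times> 'y::topological_space
      \<Rightarrow> 'h::{real_inner, banach, second_countable_topology}"
  assumes Z: "Z = graph_on X F"
    and g: "continuous_on Z g" "\<And>z. z \<in> Z \<Longrightarrow> norm (g z) \<le> B"
    and \<mu>: "\<mu> \<in> admissible X Z m" and \<nu>: "\<nu> \<in> admissible X Z m" and t: "0 \<le> t" "t \<le> 1"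
  shows "\<exists>\<tau>\<in>admissible X Z m. (\<integral>z. g z \<partial>\<tau>) = (\<integral>z. g z \<partial>\<mu>) + t *\<^sub>R ((\<integral>z. g z \<partial>\<nu>) - (\<integral>z. g z \<partial>\<mu>))"
proof -
  let ?Z = "restrict_space borel Z"
  note \<mu>P = borel_probsD[OF admissibleD(1)[OF \<mu>]] and \<nu>P = borel_probsD[OF admissibleD(1)[OF \<nu>]]
  define N where "N b = (if b then \<nu> else \<mu>)" for b
  have NP: "prob_space (N b)" "sets (N b) = sets ?Z" for b
    using \<mu>P \<nu>P by (auto simp: N_def)
  have N: "N \<in> measure_pmf (bernoulli_pmf t) \<rightarrow>\<^sub>M subprob_algebra ?Z"
    using NP by (auto simp: space_subprob_algebra intro: prob_space_imp_subprob_space)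
  define \<tau> where "\<tau> = measure_pmf (bernoulli_pmf t) \<bind> N"
  have sets: "sets \<tau> = sets ?Z"
    unfolding \<tau>_def using NP by (intro sets_bind) auto
  have prob: "prob_space \<tau>"
    unfolding \<tau>_def using NP N
    by (intro prob_space.prob_space_bind[OF measure_pmf.prob_space_axioms]) auto
  have \<tau>: "\<tau> \<in> borel_probs Z"
    using sets prob by (simp add: borel_probs_def)
  have dN: "distr (N b) (restrict_space borel X) fst = m" for b
    using admissibleD(2)[OF \<mu>] admissibleD(2)[OF \<nu>] by (simp add: N_def)
  have "prob_space m"
    using prob_space.prob_space_distr[OF \<mu>P(1), of fst "restrict_space borel X"]
      fst_measurable_graph_on[of X F] \<mu>P(2) admissibleD(2)[OF \<mu>]
    by (simp add: Z cong: measurable_cong_sets)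
  then have "distr \<tau> (restrict_space borel X) fst = m"
    unfolding \<tau>_def using fst_measurable_graph_on[of X F]
    by (subst distr_bind[OF N])
      (simp_all add: dN Z bind_const' prob_space_imp_subprob_space measure_pmf.prob_space_axioms)
  then have adm: "\<tau> \<in> admissible X Z m"
    using \<tau> by (simp add: admissible_def)
  note int = integrable_borel_probs_bounded(1)[OF _ g]
  \<comment> \<open>The vector integral is identified through its inner products with all
    \<open>w\<close>, which are integrals of bounded real functions.\<close>
  have inner: "inner w (\<integral>z. g z \<partial>\<tau>) =
      inner w ((\<integral>z. g z \<partial>\<mu>) + t *\<^sub>R ((\<integral>z. g z \<partial>\<nu>) - (\<integral>z. g z \<partial>\<mu>)))" for w
  proof -
    have "inner w (\<integral>z. g z \<partial>\<tau>) = (\<integral>z. inner w (g z) \<partial>\<tau>)"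
      using int[OF \<tau>] by simp
    also have "\<dots> = (\<integral>b. \<integral>z. inner w (g z) \<partial>N b \<partial>measure_pmf (bernoulli_pmf t))"
      unfolding \<tau>_def
    proof (rule integral_bind[OF _ _ N])
      show "(\<lambda>z. inner w (g z)) \<in> borel_measurable ?Z"
        by (intro borel_measurable_continuous_on_restrict continuous_intros g)
      show "\<bar>inner w (g z)\<bar> \<le> norm w * B" if "z \<in> space ?Z" for z
        using that g(2)[of z] Cauchy_Schwarz_ineq2[of w "g z"]
          mult_left_mono[of "norm (g z)" B "norm w"] by (simp add: space_restrict_space)
      show "AE b in measure_pmf (bernoulli_pmf t). emeasure (N b) (space (N b)) \<le> ennreal 1"
        using NP(1) by (simp add: prob_space.emeasure_space_1)
    qed (rule measure_pmf.finite_measure_axioms)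
    also have "\<dots> = (1 - t) * inner w (\<integral>z. g z \<partial>\<mu>) + t * inner w (\<integral>z. g z \<partial>\<nu>)"
      using t int[OF admissibleD(1)[OF \<mu>]] int[OF admissibleD(1)[OF \<nu>]] by (simp add: N_def)
    finally show ?thesis
      by (simp add: inner_add_right inner_diff_right algebra_simps)
  qed
  have "(\<integral>z. g z \<partial>\<tau>) = (\<integral>z. g z \<partial>\<mu>) + t *\<^sub>R ((\<integral>z. g z \<partial>\<nu>) - (\<integral>z. g z \<partial>\<mu>))"
    using inner by (metis vector_eq_rdot inner_commute)
  then show ?thesis
    using adm by blast
qed

section \<open>Stability of the value\<close>

text \<open>\<open>K\<close> stands for the Lipschitz constant \<open>L\<^sub>g\<close>. The
  measures on \<open>X\<close> are not fixed, so that estimates can be used with the two measures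
  exchanged.\<close>

locale transport_selection_problem =
  fixes X :: "'x::{banach, second_countable_topology} set"
    and F :: "'x \<Rightarrow> 'y::polish_space set"
    and Z :: "('x \<times> 'y) set"
    and g :: "'x \<times> 'y \<Rightarrow> 'h::{real_inner, banach, second_countable_topology}"
    and f :: "'h \<Rightarrow> real"
    and grad_f :: "'h \<Rightarrow> 'h"
    and L K C :: real
  assumes X_closed: "closed X"
    and Z_eq: "Z = graph_on X F"
    and F_closed_graph: "closedin (top_of_set (X \<times> UNIV)) Z"
    and g_bounded: "bounded (g ` Z)"
    and f_convex: "convex_on UNIV f"
    and f_gradient: "\<And>u. GDERIV f u :> grad_f u"
    and grad_lipschitz: "L-lipschitz_on UNIV grad_f"
    and BR_nonempty: "\<And>l x. l \<in> range grad_f \<Longrightarrow> x \<in> X \<Longrightarrow> best_response F g l x \<noteq> {}"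
    and g_continuous: "continuous_on Z g"
    and F_compact: "\<And>x. x \<in> X \<Longrightarrow> compact (F x)"
    and F_usc: "svm_usc_on X F"
    and K_nonneg: "0 \<le> K"
    and Z_lipschitz: "svm_lipschitz_on K X (\<lambda>x. {g (x, y) | y. y \<in> F x})"
    and C_eq: "C = (SUP \<mu>\<in>borel_probs Z. norm (grad_f (\<integral>z. g z \<partial>\<mu>)))"
begin

abbreviation "val \<equiv> prob_val X Z g f"

lemma closed_Z: "closed Z"
  using closedin_closed_trans[OF F_closed_graph] X_closed by (simp add: closed_Times)

lemma mem_Z_iff: "(x, y) \<in> Z \<longleftrightarrow> x \<in> X \<and> y \<in> F x"
  by (simp add: Z_eq graph_on_def)

lemma g_bound: "\<exists>B>0. \<forall>z\<in>Z. norm (g z) \<le> B"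
  using g_bounded by (auto simp: bounded_pos)

lemma g_integrable: "\<mu> \<in> borel_probs Z \<Longrightarrow> integrable \<mu> g"
  using integrable_borel_probs_bounded(1)[OF _ g_continuous] g_bound by blast

text \<open>The supremum defining \<open>C\<close> is finite: the integrals stay in a ball on which
  the Lipschitz gradient is bounded.\<close>

lemma norm_grad_le_C:
  assumes \<mu>: "\<mu> \<in> borel_probs Z"
  shows "norm (grad_f (\<integral>z. g z \<partial>\<mu>)) \<le> C"
  unfolding C_eq
proof (rule cSUP_upper[OF \<mu>])
  obtain B where B: "0 < B" "\<And>z. z \<in> Z \<Longrightarrow> norm (g z) \<le> B"
    using g_bound by blast
  show "bdd_above ((\<lambda>\<mu>. norm (grad_f (\<integral>z. g z \<partial>\<mu>))) ` borel_probs Z)"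
  proof (rule bdd_aboveI2)
    fix \<mu> assume "\<mu> \<in> borel_probs Z"
    then have "norm (\<integral>z. g z \<partial>\<mu>) \<le> B"
      by (rule integrable_borel_probs_bounded(2)[OF _ g_continuous B(2)])
    then have "L * norm (\<integral>z. g z \<partial>\<mu>) \<le> L * B"
      using lipschitz_on_nonneg[OF grad_lipschitz] by (intro mult_left_mono)
    moreover have "norm (grad_f (\<integral>z. g z \<partial>\<mu>) - grad_f 0) \<le> L * norm (\<integral>z. g z \<partial>\<mu>)"
      using lipschitz_onD[OF grad_lipschitz, of "\<integral>z. g z \<partial>\<mu>" 0] by (simp add: dist_norm)
    ultimately show "norm (grad_f (\<integral>z. g z \<partial>\<mu>)) \<le> norm (grad_f 0) + L * B"
      using norm_triangle_sub[of "grad_f (\<integral>z. g z \<partial>\<mu>)" "grad_f 0"] by linarith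
  qed
qed

text \<open>The tangent of \<open>f\<close> at \<open>0\<close> is an affine minorant, bounded below
  on the ball that contains all the integrals. This makes the real infimum in
  \<open>prob_val\<close> a genuine one.\<close>

lemma cost_bdd_below: "bdd_below ((\<lambda>\<mu>. f (\<integral>z. g z \<partial>\<mu>)) ` admissible X Z m)"
proof -
  obtain B where B: "0 < B" "\<And>z. z \<in> Z \<Longrightarrow> norm (g z) \<le> B"
    using g_bound by blast
  show ?thesis
  proof (rule bdd_belowI2)
    fix \<mu> assume "\<mu> \<in> admissible X Z m"
    then have "norm (\<integral>z. g z \<partial>\<mu>) \<le> B"
      by (intro integrable_borel_probs_bounded(2)[OF _ g_continuous B(2)] admissibleD)
    then have "norm (grad_f 0) * norm (\<integral>z. g z \<partial>\<mu>) \<le> norm (grad_f 0) * B"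
      by (intro mult_left_mono) auto
    moreover have "\<bar>inner (grad_f 0) (\<integral>z. g z \<partial>\<mu>)\<bar> \<le> norm (grad_f 0) * norm (\<integral>z. g z \<partial>\<mu>)"
      by (rule Cauchy_Schwarz_ineq2)
    ultimately show "f 0 - norm (grad_f 0) * B \<le> f (\<integral>z. g z \<partial>\<mu>)"
      using convex_gradient_above_tangent[OF f_convex f_gradient, of 0 "\<integral>z. g z \<partial>\<mu>"] by auto
  qed
qed

lemma val_le: "\<mu> \<in> admissible X Z m \<Longrightarrow> val m \<le> f (\<integral>z. g z \<partial>\<mu>)"
  unfolding prob_val_def by (rule cINF_lower[OF cost_bdd_below])

text \<open>All best responses share the same cost, so the arbitrary choice does not affect the
  value wherever one exists. No measurability of the choice is claimed; a measurable selection is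
  constructed separately.\<close>

definition min_cost :: "'h \<Rightarrow> 'x \<Rightarrow> real" where
  "min_cost l x = inner l (g (x, SOME y. y \<in> best_response F g l x))"

context
  fixes l assumes l: "l \<in> range grad_f"
begin

lemma min_cost_attained: "x \<in> X \<Longrightarrow> \<exists>y\<in>F x. min_cost l x = inner l (g (x, y))"
  using some_in_eq[of "best_response F g l x"] BR_nonempty[OF l]
  by (auto simp: min_cost_def best_response_def is_arg_min_def)

lemma min_cost_le: "x \<in> X \<Longrightarrow> y \<in> F x \<Longrightarrow> min_cost l x \<le> inner l (g (x, y))"
  using some_in_eq[of "best_response F g l x"] BR_nonempty[OF l]
  by (auto simp: min_cost_def best_response_def is_arg_min_linorder)

text \<open>A best response at one point has a counterpart at the other whose \<open>g\<close>-value
  is within \<open>K\<close> times the distance; this counterpart is a competitor there, and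
  Cauchy-Schwarz brings in \<open>norm l\<close>.\<close>

lemma min_cost_lipschitz: "(norm l * K)-lipschitz_on X (min_cost l)"
proof (rule lipschitz_onI)
  have le: "min_cost l x1 \<le> min_cost l x2 + norm l * K * dist x1 x2" if x: "x1 \<in> X" "x2 \<in> X" for x1 x2
  proof -
    obtain y2 where y2: "y2 \<in> F x2" "min_cost l x2 = inner l (g (x2, y2))"
      using min_cost_attained[OF x(2)] by auto
    have "g (x2, y2) \<in> {u + v | u v. u \<in> {g (x1, y) | y. y \<in> F x1} \<and> v \<in> cball 0 (K * dist x2 x1)}"
      using Z_lipschitz x y2(1) unfolding svm_lipschitz_on_def by blast
    then obtain y1 v where y1: "y1 \<in> F x1" "g (x2, y2) = g (x1, y1) + v" "norm v \<le> K * dist x2 x1"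
      by auto
    have "min_cost l x1 \<le> inner l (g (x1, y1))"
      by (rule min_cost_le[OF x(1) y1(1)])
    also have "\<dots> = min_cost l x2 - inner l v"
      by (simp add: y2(2) y1(2) inner_add_right)
    finally have "min_cost l x1 \<le> min_cost l x2 - inner l v" .
    moreover have "\<bar>inner l v\<bar> \<le> norm l * norm v"
      by (rule Cauchy_Schwarz_ineq2)
    moreover have "norm l * norm v \<le> norm l * (K * dist x2 x1)"
      using y1(3) by (intro mult_left_mono) auto
    ultimately show ?thesis
      by (simp add: dist_commute mult.assoc)
  qed
  fix x1 x2 assume x: "x1 \<in> X" "x2 \<in> X"
  show "dist (min_cost l x1) (min_cost l x2) \<le> norm l * K * dist x1 x2"
    using le[OF x] le[OF x(2,1)] by (simp add: dist_real_def dist_commute abs_le_iff)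
qed (use K_nonneg in simp)

lemma min_cost_integrable:
  assumes "m \<in> borel_probs X"
  shows "integrable m (min_cost l)"
proof -
  obtain B where B: "0 < B" "\<And>z. z \<in> Z \<Longrightarrow> norm (g z) \<le> B"
    using g_bound by blast
  show ?thesis
  proof (rule integrable_borel_probs_bounded(1)[OF assms])
    show "continuous_on X (min_cost l)"
      by (rule lipschitz_on_continuous_on[OF min_cost_lipschitz])
    fix x assume x: "x \<in> X"
    then obtain y where y: "y \<in> F x" "min_cost l x = inner l (g (x, y))"
      using min_cost_attained by auto
    have "\<bar>inner l (g (x, y))\<bar> \<le> norm l * norm (g (x, y))"
      by (rule Cauchy_Schwarz_ineq2)
    also have "\<dots> \<le> norm l * B"
      using B(2)[of "(x, y)"] x y by (intro mult_left_mono) (auto simp: mem_Z_iff)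
    finally show "norm (min_cost l x) \<le> norm l * B"
      using y by simp
  qed
qed

text \<open>The inequality holds fibrewise, and the first marginal turns the integral over
  \<open>\<mu>\<close> into one over \<open>m\<close>.\<close>

lemma integral_min_cost_le:
  assumes \<mu>: "\<mu> \<in> admissible X Z m" and m: "m \<in> borel_probs X"
  shows "(\<integral>x. min_cost l x \<partial>m) \<le> inner l (\<integral>z. g z \<partial>\<mu>)"
proof -
  note \<mu>P = borel_probsD[OF admissibleD(1)[OF \<mu>]]
  let ?X = "restrict_space borel X"
  have fst: "fst \<in> \<mu> \<rightarrow>\<^sub>M ?X"
    using fst_measurable_graph_on[of X F] \<mu>P(2) by (simp add: Z_eq cong: measurable_cong_sets)
  have meas: "min_cost l \<in> borel_measurable ?X"
    by (intro borel_measurable_continuous_on_restrict lipschitz_on_continuous_on[OF min_cost_lipschitz])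
  have int: "integrable \<mu> (\<lambda>z. min_cost l (fst z))"
    using min_cost_integrable[OF m] integrable_distr[OF fst, of "min_cost l"] admissibleD(2)[OF \<mu>] by simp
  have "(\<integral>x. min_cost l x \<partial>m) = (\<integral>z. min_cost l (fst z) \<partial>\<mu>)"
    using integral_distr[OF fst meas] admissibleD(2)[OF \<mu>] by simp
  also have "\<dots> \<le> (\<integral>z. inner l (g z) \<partial>\<mu>)"
  proof (rule integral_mono[OF int])
    fix z assume "z \<in> space \<mu>"
    then have "(fst z, snd z) \<in> Z"
      using \<mu>P(3) by simp
    then have "fst z \<in> X" "snd z \<in> F (fst z)"
      unfolding mem_Z_iff by auto
    then show "min_cost l (fst z) \<le> inner l (g z)"
      using min_cost_le[of "fst z" "snd z"] by simp
  qed (use g_integrable[OF admissibleD(1)[OF \<mu>]] in simp)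
  also have "\<dots> = inner l (\<integral>z. g z \<partial>\<mu>)"
    using g_integrable[OF admissibleD(1)[OF \<mu>]] by simp
  finally show ?thesis .
qed

text \<open>Pairs of points and best responses form a closed subset of \<open>Z\<close>, so a
  measurable selection \<open>s\<close> of best responses exists; the image of \<open>m\<close>
  under \<open>x \<mapsto> (x, s x)\<close> attains the fibrewise minimum.\<close>

lemma integral_min_cost_attained:
  assumes m: "m \<in> borel_probs X"
  shows "\<exists>\<mu>\<in>admissible X Z m. inner l (\<integral>z. g z \<partial>\<mu>) = (\<integral>x. min_cost l x \<partial>m)"
proof -
  let ?X = "restrict_space borel X" and ?Z = "restrict_space borel Z"
  note mP = borel_probsD[OF m]
  \<comment> \<open>The inequality already characterises best responses within \<open>Z\<close>, as
    the reverse one always holds there.\<close>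
  have closed: "closed {z \<in> Z. inner l (g z) \<le> min_cost l (fst z)}"
  proof (rule continuous_on_closed_Collect_le[OF _ _ closed_Z])
    show "continuous_on Z (\<lambda>z. min_cost l (fst z))"
      by (rule continuous_on_compose2[OF lipschitz_on_continuous_on[OF min_cost_lipschitz]])
        (auto intro!: continuous_intros simp: Z_eq graph_on_def)
  qed (intro continuous_intros g_continuous)
  have "\<exists>s\<in>borel_measurable ?X.
      \<forall>x\<in>X. s x \<in> F x \<and> (x, s x) \<in> {z \<in> Z. inner l (g z) \<le> min_cost l (fst z)}"
  proof (rule usc_measurable_selection[OF X_closed F_usc _ closed])
    fix x assume "x \<in> X"
    with min_cost_attained[OF this]
    show "\<exists>y\<in>F x. (x, y) \<in> {z \<in> Z. inner l (g z) \<le> min_cost l (fst z)}"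
      by (auto simp: mem_Z_iff)
  qed (rule F_compact)
  then obtain s where s: "s \<in> borel_measurable ?X"
    and sF: "\<And>x. x \<in> X \<Longrightarrow> s x \<in> F x" and le: "\<And>x. x \<in> X \<Longrightarrow> inner l (g (x, s x)) \<le> min_cost l x"
    by auto
  have eq: "inner l (g (x, s x)) = min_cost l x" if "x \<in> X" for x
    using le[OF that] min_cost_le[OF that sF[OF that]] by simp
  have "(\<lambda>x. (x, s x)) \<in> ?X \<rightarrow>\<^sub>M ?Z"
  proof (intro measurable_restrict_space2 borel_measurable_Pair s)
    show "(\<lambda>x. x) \<in> borel_measurable ?X"
      by (intro measurable_restrict_space1) simp
    show "(\<lambda>x. (x, s x)) \<in> space ?X \<rightarrow> Z"
      using sF by (auto simp: space_restrict_space mem_Z_iff)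
  qed
  then have ms: "(\<lambda>x. (x, s x)) \<in> m \<rightarrow>\<^sub>M ?Z"
    using mP(2) by (simp cong: measurable_cong_sets)
  define \<mu> where "\<mu> = distr m ?Z (\<lambda>x. (x, s x))"
  have "\<mu> \<in> borel_probs Z"
    using prob_space.prob_space_distr[OF mP(1) ms] by (simp add: \<mu>_def borel_probs_def)
  moreover have "distr \<mu> ?X fst = m"
  proof -
    have "fst \<in> ?Z \<rightarrow>\<^sub>M ?X"
      unfolding Z_eq by (rule fst_measurable_graph_on)
    then have "distr \<mu> ?X fst = distr m ?X (\<lambda>x. x)"
      unfolding \<mu>_def by (subst distr_distr[OF _ ms]) (simp_all add: comp_def)
    also have "\<dots> = m"
      using mP(2) by (intro distr_id2) simp
    finally show ?thesis .
  qed
  ultimately have adm: "\<mu> \<in> admissible X Z m"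
    by (simp add: admissible_def)
  have "inner l (\<integral>z. g z \<partial>\<mu>) = (\<integral>z. inner l (g z) \<partial>\<mu>)"
    using g_integrable[OF \<open>\<mu> \<in> borel_probs Z\<close>] by simp
  also have "\<dots> = (\<integral>x. inner l (g (x, s x)) \<partial>m)"
    unfolding \<mu>_def
    by (rule integral_distr[OF ms]) (intro borel_measurable_continuous_on_restrict continuous_intros g_continuous)
  also have "\<dots> = (\<integral>x. min_cost l x \<partial>m)"
    using eq mP(3) by (intro Bochner_Integration.integral_cong) auto
  finally show ?thesis
    using adm by blast
qed

end

text \<open>Any gradient value serves as \<open>l\<close>; only the existence of a measurable
  selection matters.\<close>

lemma admissible_nonempty: "m \<in> borel_probs X \<Longrightarrow> admissible X Z m \<noteq> {}"
  using integral_min_cost_attained[of "grad_f 0" m] by auto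

lemma val_diff_le:
  assumes m0: "m0 \<in> borel_probs_1 X" and m1: "m1 \<in> borel_probs_1 X"
  shows "val m0 - val m1 \<le> K * C * kr_dist X m0 m1"
proof (rule field_le_epsilon)
  fix e :: real assume e: "0 < e"
  note m0' = borel_probs_1D(1)[OF m0] and m1' = borel_probs_1D(1)[OF m1]
  obtain B where B: "0 < B" "\<And>z. z \<in> Z \<Longrightarrow> norm (g z) \<le> B"
    using g_bound by blast
  have L: "0 \<le> L"
    by (rule lipschitz_on_nonneg[OF grad_lipschitz])
  \<comment> \<open>The remainder constant of the first-order condition, for two integrals in the
    ball of radius \<open>B\<close>, hence at distance at most \<open>2 * B\<close>.\<close>
  let ?A = "1 + L * (2 * B)\<^sup>2"
  have A: "0 < ?A"
    using L by (intro add_pos_nonneg) auto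
  \<comment> \<open>\<open>\<delta>\<close> must be at most \<open>1\<close> to be a mixture weight,
    and \<open>\<delta> * ?A \<le> e\<close> makes the first-order remainder at most
    \<open>e\<close>.\<close>
  define \<delta> where "\<delta> = min 1 (e / ?A)"
  have \<delta>: "0 < \<delta>" "\<delta> \<le> 1"
    using e A by (auto simp: \<delta>_def)
  have "\<delta> * ?A \<le> e / ?A * ?A"
    using A by (intro mult_right_mono) (auto simp: \<delta>_def)
  then have \<delta>A: "\<delta> * ?A \<le> e"
    using A by simp
  have "val m0 < val m0 + \<delta>\<^sup>2"
    using \<delta> by simp
  then obtain \<mu>0 where \<mu>0: "\<mu>0 \<in> admissible X Z m0" "f (\<integral>z. g z \<partial>\<mu>0) < val m0 + \<delta>\<^sup>2"
    unfolding prob_val_def using cINF_less_iff[OF admissible_nonempty[OF m0'] cost_bdd_below] by blast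
  define u where "u = (\<integral>z. g z \<partial>\<mu>0)"
  define l where "l = grad_f u"
  have l: "l \<in> range grad_f"
    by (simp add: l_def)
  have "norm l \<le> C"
    unfolding l_def u_def by (rule norm_grad_le_C[OF admissibleD(1)[OF \<mu>0(1)]])
  obtain \<nu> where \<nu>: "\<nu> \<in> admissible X Z m0" "inner l (\<integral>z. g z \<partial>\<nu>) = (\<integral>x. min_cost l x \<partial>m0)"
    using integral_min_cost_attained[OF l m0'] by blast
  define v where "v = (\<integral>z. g z \<partial>\<nu>)"
  have "norm u \<le> B" "norm v \<le> B"
    unfolding u_def v_def using \<mu>0(1) \<nu>(1)
    by (auto intro!: integrable_borel_probs_bounded(2)[OF _ g_continuous B(2)] dest: admissibleD)
  then have "norm (v - u) \<le> 2 * B"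
    using norm_triangle_ineq4[of v u] by linarith
  \<comment> \<open>The mixture with weight \<open>\<delta>\<close> is admissible for
    \<open>m0\<close>, so its cost is at least \<open>val m0\<close>.\<close>
  moreover have "f u \<le> f (u + \<delta> *\<^sub>R (v - u)) + \<delta>\<^sup>2"
  proof -
    obtain \<tau> where "\<tau> \<in> admissible X Z m0" "(\<integral>z. g z \<partial>\<tau>) = u + \<delta> *\<^sub>R (v - u)"
      using admissible_mixture[OF Z_eq g_continuous B(2) \<mu>0(1) \<nu>(1), of \<delta>] \<delta>
      unfolding u_def v_def by auto
    then show ?thesis
      using val_le[of \<tau> m0] \<mu>0(2) by (simp add: u_def)
  qed
  ultimately have first_order: "- \<delta> * ?A \<le> inner l (v - u)"
    unfolding l_def by (intro near_minimiser_first_order[OF f_convex f_gradient grad_lipschitz] \<delta>)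
  have kr: "(\<integral>x. min_cost l x \<partial>m0) - (\<integral>x. min_cost l x \<partial>m1) \<le> K * C * kr_dist X m0 m1"
  proof -
    have "(\<integral>x. min_cost l x \<partial>m0) - (\<integral>x. min_cost l x \<partial>m1) \<le> norm l * K * kr_dist X m0 m1"
      by (rule integral_diff_le_lipschitz_kr_dist[OF m0 m1 min_cost_lipschitz[OF l]])
    also have "\<dots> \<le> C * K * kr_dist X m0 m1"
      using \<open>norm l \<le> C\<close> K_nonneg kr_dist_nonneg[OF m0 m1] by (intro mult_right_mono) auto
    finally show ?thesis
      by (simp add: mult.commute)
  qed
  have "val m0 - K * C * kr_dist X m0 m1 - e \<le> val m1"
    unfolding prob_val_def[of X Z g f m1]
  proof (rule cINF_greatest[OF admissible_nonempty[OF m1']])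
    fix \<mu> assume \<mu>: "\<mu> \<in> admissible X Z m1"
    have "val m0 + inner l ((\<integral>z. g z \<partial>\<mu>) - u) \<le> f (\<integral>z. g z \<partial>\<mu>)"
      using convex_gradient_above_tangent[OF f_convex f_gradient, of u "\<integral>z. g z \<partial>\<mu>"]
        val_le[OF \<mu>0(1)] by (simp add: u_def l_def)
    moreover have "inner l u - e \<le> (\<integral>x. min_cost l x \<partial>m0)"
      using first_order \<delta>A \<nu>(2) by (simp add: v_def inner_diff_right)
    ultimately show "val m0 - K * C * kr_dist X m0 m1 - e \<le> f (\<integral>z. g z \<partial>\<mu>)"
      using kr integral_min_cost_le[OF l \<mu> m1'] by (simp add: inner_diff_right)
  qed
  then show "val m0 - val m1 \<le> K * C * kr_dist X m0 m1 + e"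
    by simp
qed

text \<open>Both integrals are taken over the same \<open>\<nu>\<close>, where the integrands differ
  by at most \<open>K\<close> times the distance of the two points of \<open>X\<close>. That
  distance depends only on the image \<open>\<rho>\<close> of \<open>\<nu>\<close>, whose transport
  cost is optimal.\<close>

lemma bridging_output_integral_diff:
  assumes m0: "m0 \<in> borel_probs_1 X" and m1: "m1 \<in> borel_probs_1 X"
    and bridge: "bridging_output X Z g K m0 m1 \<mu>0 \<mu>1"
  shows "norm ((\<integral>z. g z \<partial>\<mu>1) - (\<integral>z. g z \<partial>\<mu>0)) \<le> K * kr_dist X m0 m1"
proof -
  let ?Z = "restrict_space borel Z" and ?XX = "restrict_space borel (X \<times> X)"
  let ?p = "\<lambda>((x, y), x'). (x, x')"
  obtain \<rho> \<nu> s where \<rho>: "optimal_transport X m0 m1 \<rho>" and \<nu>: "\<nu> \<in> borel_probs (Z \<times> X)"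
    and \<mu>0: "distr \<nu> ?Z fst = \<mu>0" and \<nu>\<rho>: "distr \<nu> ?XX ?p = \<rho>"
    and s: "s \<in> restrict_space borel (Z \<times> X) \<rightarrow>\<^sub>M ?Z"
    and sel: "\<And>p. p \<in> Z \<times> X \<Longrightarrow> s p \<in> bridge_map Z g K p" and \<mu>1: "\<mu>1 = distr \<nu> ?Z s"
    using bridge unfolding bridging_output_def by blast
  note \<nu>P = borel_probsD[OF \<nu>]
  interpret \<nu>: prob_space \<nu>
    by (rule \<nu>P(1))
  have s': "s \<in> \<nu> \<rightarrow>\<^sub>M ?Z"
    using s \<nu>P(2) by (simp cong: measurable_cong_sets)
  have "fst \<in> restrict_space borel (Z \<times> X) \<rightarrow>\<^sub>M ?Z"
    by (intro measurable_restrict_space3 borel_measurable_continuous_onI continuous_intros) auto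
  then have fst': "fst \<in> \<nu> \<rightarrow>\<^sub>M ?Z"
    using \<nu>P(2) by (simp cong: measurable_cong_sets)
  have "?p \<in> restrict_space borel (Z \<times> X) \<rightarrow>\<^sub>M ?XX"
    unfolding case_prod_unfold
    by (intro measurable_restrict_space3 borel_measurable_continuous_onI continuous_intros)
      (auto simp: mem_Z_iff)
  then have p': "?p \<in> \<nu> \<rightarrow>\<^sub>M ?XX"
    using \<nu>P(2) by (simp cong: measurable_cong_sets)
  have g: "g \<in> borel_measurable ?Z"
    by (rule borel_measurable_continuous_on_restrict[OF g_continuous])
  have \<mu>0P: "\<mu>0 \<in> borel_probs Z" and \<mu>1P: "\<mu>1 \<in> borel_probs Z"
    using \<nu>.prob_space_distr[OF fst'] \<nu>.prob_space_distr[OF s'] by (auto simp: \<mu>1 borel_probs_def simp flip: \<mu>0)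
  have int0: "integrable \<nu> (\<lambda>p. g (fst p))" and int1: "integrable \<nu> (\<lambda>p. g (s p))"
    using g_integrable[OF \<mu>0P] g_integrable[OF \<mu>1P] integrable_distr[OF fst', of g] integrable_distr[OF s', of g]
    by (simp_all add: \<mu>0 \<mu>1)
  have bound: "norm (g (s p) - g (fst p)) \<le> K * dist (fst (?p p)) (snd (?p p))" if "p \<in> Z \<times> X" for p
    using sel[OF that] by (auto simp: bridge_map_def split: prod.splits)
  have dist_meas: "(\<lambda>p. ennreal (dist (fst p) (snd p))) \<in> borel_measurable ?XX"
    by (intro measurable_restrict_space1 measurable_compose[OF _ measurable_ennreal]
        borel_measurable_continuous_onI continuous_intros)
  have "(\<integral>z. g z \<partial>\<mu>1) - (\<integral>z. g z \<partial>\<mu>0) = (\<integral>p. g (s p) - g (fst p) \<partial>\<nu>)"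
    using int0 int1 integral_distr[OF fst' g] integral_distr[OF s' g] by (simp add: \<mu>0 \<mu>1)
  \<comment> \<open>The estimate continues in \<open>ennreal\<close>, where the cost of the plan is
    stated.\<close>
  then have "ennreal (norm ((\<integral>z. g z \<partial>\<mu>1) - (\<integral>z. g z \<partial>\<mu>0))) \<le> ennreal (\<integral>p. norm (g (s p) - g (fst p)) \<partial>\<nu>)"
    by (simp add: ennreal_leI integral_norm_bound)
  also have "\<dots> = (\<integral>\<^sup>+p. norm (g (s p) - g (fst p)) \<partial>\<nu>)"
    using int0 int1 by (intro nn_integral_eq_integral[symmetric]) auto
  also have "\<dots> \<le> (\<integral>\<^sup>+p. ennreal K * ennreal (dist (fst (?p p)) (snd (?p p))) \<partial>\<nu>)"
    using bound \<nu>P(3) K_nonneg by (intro nn_integral_mono) (auto simp flip: ennreal_mult intro: ennreal_leI)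
  also have "\<dots> = (\<integral>\<^sup>+p. ennreal K * ennreal (dist (fst p) (snd p)) \<partial>\<rho>)"
    unfolding \<nu>\<rho>[symmetric]
    by (rule nn_integral_distr[OF p', symmetric])
      (auto intro!: borel_measurable_times_ennreal dist_meas)
  also have "\<dots> = ennreal K * (\<integral>\<^sup>+p. ennreal (dist (fst p) (snd p)) \<partial>\<rho>)"
    by (rule nn_integral_cmult) (simp add: dist_meas flip: \<nu>\<rho>)
  also have "\<dots> \<le> ennreal K * ennreal (kr_dist X m0 m1)"
    by (intro mult_left_mono optimal_transport_cost_le_kr_dist[OF m0 m1 \<rho>]) simp
  also have "\<dots> = ennreal (K * kr_dist X m0 m1)"
    using K_nonneg kr_dist_nonneg[OF m0 m1] by (simp add: ennreal_mult)
  finally show ?thesis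
    using K_nonneg kr_dist_nonneg[OF m0 m1] by (simp add: ennreal_le_iff)
qed

text \<open>One copy of \<open>K * C * kr_dist X m0 m1\<close> comes from the tangent inequality at
  the new integral, where the gradient is bounded by \<open>C\<close>; the other comes from
  comparing the two values.\<close>

lemma bridging_output_near_minimiser:
  assumes m0: "m0 \<in> borel_probs_1 X" and m1: "m1 \<in> borel_probs_1 X"
    and min0: "eps_minimizer X Z g f m0 \<epsilon> \<mu>0" and adm: "\<mu>1 \<in> admissible X Z m1"
    and bridge: "bridging_output X Z g K m0 m1 \<mu>0 \<mu>1"
  shows "eps_minimizer X Z g f m1 (\<epsilon> + 2 * (K * C * kr_dist X m0 m1)) \<mu>1"
proof -
  let ?u0 = "\<integral>z. g z \<partial>\<mu>0" and ?u1 = "\<integral>z. g z \<partial>\<mu>1"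
  have C: "norm (grad_f ?u1) \<le> C"
    by (rule norm_grad_le_C[OF admissibleD(1)[OF adm]])
  have "f ?u1 - f ?u0 \<le> inner (grad_f ?u1) (?u1 - ?u0)"
    using convex_gradient_above_tangent[OF f_convex f_gradient, of ?u1 ?u0]
    by (simp add: inner_diff_right)
  also have "\<dots> \<le> norm (grad_f ?u1) * norm (?u1 - ?u0)"
    by (rule norm_cauchy_schwarz)
  also have "\<dots> \<le> C * (K * kr_dist X m0 m1)"
    using C bridging_output_integral_diff[OF m0 m1 bridge] order_trans[OF norm_ge_zero C]
    by (intro mult_mono) auto
  finally have "f ?u1 \<le> f ?u0 + K * C * kr_dist X m0 m1"
    by (simp add: mult.commute mult.left_commute)
  then show ?thesis
    using min0 adm val_diff_le[OF m0 m1] by (simp add: eps_minimizer_def)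
qed

end

theorem theorem4p7:
  fixes X :: "'x::{banach, second_countable_topology} set"
    and F :: "'x \<Rightarrow> 'y::polish_space set"
    and Z :: "('x \<times> 'y) set"
    and g :: "'x \<times> 'y \<Rightarrow> 'h::{real_inner, banach, second_countable_topology}"
    and f :: "'h \<Rightarrow> real"
    and grad_f :: "'h \<Rightarrow> 'h"
    and L L\<^sub>g M C \<epsilon>\<^sub>0 :: real
    and m\<^sub>0 m\<^sub>1 :: "'x measure"
    and \<mu>\<^sub>0 :: "('x \<times> 'y) measure"
  assumes X_closed: "closed X"
    and Z_eq: "Z = graph_on X F"
    and F_nonempty: "\<And>x. x \<in> X \<Longrightarrow> F x \<noteq> {}"
    and F_closed_graph: "closedin (top_of_set (X \<times> UNIV)) Z"
    and g_measurable: "g \<in> borel_measurable (restrict_space borel Z)"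
    and f_measurable: "f \<in> borel_measurable borel"
    and g_bounded: "bounded (g ` Z)"
    and f_convex: "convex_on UNIV f"
    and f_gradient: "\<And>u. GDERIV f u :> grad_f u"
    and grad_lipschitz: "L-lipschitz_on UNIV grad_f"
    and g_lsc: "\<And>l. l \<in> range grad_f \<Longrightarrow> lsc_on Z (\<lambda>z. inner l (g z))"
    and G_lsc: "\<And>l. l \<in> range grad_f \<Longrightarrow>
      svm_lsc_on X (\<lambda>x. {inner l (g (x, y)) | y. y \<in> F x})"
    and BR_nonempty: "\<And>l x. l \<in> range grad_f \<Longrightarrow> x \<in> X \<Longrightarrow> best_response F g l x \<noteq> {}"
    and g_continuous: "continuous_on Z g"
    and F_compact: "\<And>x. x \<in> X \<Longrightarrow> compact (F x)"
    and F_usc: "svm_usc_on X F"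
    and Lg_nonneg: "0 \<le> L\<^sub>g"
    and Z_lipschitz: "svm_lipschitz_on L\<^sub>g X (\<lambda>x. {g (x, y) | y. y \<in> F x})"
    and M_eq: "M = (SUP z\<in>Z. norm (g z))"
    and C_eq: "C = (SUP \<mu>\<in>borel_probs Z. norm (grad_f (\<integral>z. g z \<partial>\<mu>)))"
    and m0: "m\<^sub>0 \<in> borel_probs_1 X"
    and m1: "m\<^sub>1 \<in> borel_probs_1 X"
    and eps0_nonneg: "0 \<le> \<epsilon>\<^sub>0"
    and mu0: "eps_minimizer X Z g f m\<^sub>0 \<epsilon>\<^sub>0 \<mu>\<^sub>0"
  shows "\<bar>prob_val X Z g f m\<^sub>0 - prob_val X Z g f m\<^sub>1\<bar> \<le> L\<^sub>g * (C + L * M) * kr_dist X m\<^sub>0 m\<^sub>1 \<and>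
    (\<forall>\<mu>\<^sub>1\<in>admissible X Z m\<^sub>1. bridging_output X Z g L\<^sub>g m\<^sub>0 m\<^sub>1 \<mu>\<^sub>0 \<mu>\<^sub>1 \<longrightarrow>
      eps_minimizer X Z g f m\<^sub>1 (\<epsilon>\<^sub>0 + 2 * L\<^sub>g * (C + L * M) * kr_dist X m\<^sub>0 m\<^sub>1) \<mu>\<^sub>1)"
proof -
  interpret transport_selection_problem X F Z g f grad_f L L\<^sub>g C
    by unfold_locales (fact assms)+
  let ?d = "kr_dist X m\<^sub>0 m\<^sub>1"
  have "X \<noteq> {}"
    by (rule borel_probs_1D(2)[OF m0])
  \<comment> \<open>A point of \<open>Z\<close> is needed to see that the real supremum
    \<open>M\<close> is non-negative.\<close>
  then obtain z where z: "z \<in> Z"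
    using F_nonempty mem_Z_iff by blast
  have "bdd_above ((\<lambda>z. norm (g z)) ` Z)"
    using g_bound by (auto intro: bdd_aboveI2)
  then have "norm (g z) \<le> M"
    unfolding M_eq using z by (intro cSUP_upper)
  then have M: "0 \<le> M"
    using norm_ge_zero[of "g z"] by linarith
  have d: "0 \<le> ?d"
    by (rule kr_dist_nonneg[OF m0 m1])
  \<comment> \<open>The estimates above carry the constant \<open>C\<close>; passing to
    \<open>C + L * M\<close> only enlarges the bounds.\<close>
  have "0 \<le> L\<^sub>g * (L * M) * ?d"
    using Lg_nonneg lipschitz_on_nonneg[OF grad_lipschitz] M d by simp
  then have le: "L\<^sub>g * C * ?d \<le> L\<^sub>g * (C + L * M) * ?d"
    by (simp add: algebra_simps)
  have "\<bar>val m\<^sub>0 - val m\<^sub>1\<bar> \<le> L\<^sub>g * C * ?d"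
    using val_diff_le[OF m0 m1] val_diff_le[OF m1 m0] by (simp add: abs_le_iff kr_dist_commute[of X m\<^sub>1 m\<^sub>0])
  moreover have "eps_minimizer X Z g f m\<^sub>1 (\<epsilon>\<^sub>0 + 2 * L\<^sub>g * (C + L * M) * ?d) \<mu>\<^sub>1"
    if "\<mu>\<^sub>1 \<in> admissible X Z m\<^sub>1" "bridging_output X Z g L\<^sub>g m\<^sub>0 m\<^sub>1 \<mu>\<^sub>0 \<mu>\<^sub>1" for \<mu>\<^sub>1
    using bridging_output_near_minimiser[OF m0 m1 mu0 that] le by (simp add: eps_minimizer_def)
  ultimately show ?thesis
    using le by auto
qed

end
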